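(* For each $n\ge 1$ let $G_n=(D_n,S_n,E_n)$ be a network with rate functions $\lambda_n:D_n\to(0,\infty)$ and $\mu_n:S_n\to(0,\infty)$, and let $\boldsymbol{X}_n$ be the associated load balancing process. Suppose that there exists a sequence of servers $\{u_n\in S_n: n\ge 1\}$ with a skewed neighborhood, i.e., there is a fixed $\alpha=(a,\lambda_{\min},\mu_{\max})\in\mathbb{N}\times(0,\infty)\times(0,\infty)$ such that $\lim_{n\to\infty}|\mathcal{N}_n^\alpha(u_n)|=\infty$. Then $$\lim_{n\to\infty}\liminf_{t\to\infty}P\left(\boldsymbol{X}_n(t,u_n)\ge k\right)=1\quad\text{for all } k\in\mathbb{N}.$$
   Context: $\mathbb{N}=\{0,1,2,\dots\}$. A network is a bipartite graph $G=(D,S,E)$ with finite sets $D$ (dispatchers) and $S$ (servers) and $E\subset D\times S$; dispatcher $d$ can send tasks to server $u$ only if $(d,u)\in E$ (then $d$ and $u$ are called compatible). Load balancing process: given $\lambda:D\to(0,\infty)$ and $\mu:S\to(0,\infty)$, dispatcher $d$ receives tasks as an independent Poisson process of rate $\lambda(d)$ and sends each task to a server chosen uniformly at random among the compatible servers with the least number of tasks; each server $u$ executes tasks sequentially with independent exponential service times of rate $\mu(u)$. $\boldsymbol{X}(t,u)$ is the number of tasks in server $u$ at time $t$. Thus $\boldsymbol{X}$ is the continuous-time Markov chain on $\mathbb{N}^S$ that jumps from $x$ to $x+e(u)$ at rate $\sum_{d:(d,u)\in E}\frac{\lambda(d)}{|\mathcal{M}(d,x)|}\mathbf{1}\{u\in\mathcal{M}(d,x)\}$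 and from $x$ to $x-e(u)$ at rate $\mu(u)\mathbf{1}\{x(u)>0\}$, where $e(u)$ is the canonical basis vector, $\mathcal{N}(d)=\{u\in S:(d,u)\in E\}$ and $\mathcal{M}(d,x)$ is the set of minimizers of $x(u)$ over $u\in\mathcal{N}(d)$. No ergodicity and no particular initial distribution is assumed. For a network $G_n$: $\mathcal{N}_n(d)=\{v\in S_n:(d,v)\in E_n\}$ for $d\in D_n$, $\mathcal{N}_n(u)=\{e\in D_n:(e,u)\in E_n\}$ for $u\in S_n$, and $\deg_n(d)=|\mathcal{N}_n(d)|$. For $\alpha=(a,\lambda_{\min},\mu_{\max})$ and $u\in S_n$, $$\mathcal{N}_n^\alpha(u)=\{d\in\mathcal{N}_n(u):\deg_n(d)\le a,\ \lambda_n(d)\ge\lambda_{\min}\text{ and }\mu_n(v)\le\mu_{\max}\text{ for all }v\in\mathcal{N}_n(d)\}.$$ *)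

theory Defs
  imports "HOL-Probability.Probability"
begin

section \<open>Networks\<close>

record ('d, 's) network =
  dispatchers :: "'d set"
  servers :: "'s set"
  edges :: "('d \<times> 's) set"

definition is_network :: "('d, 's) network \<Rightarrow> bool" where
  "is_network G \<longleftrightarrow> finite (dispatchers G) \<and> finite (servers G) \<and>
     edges G \<subseteq> dispatchers G \<times> servers G"

definition compatible_servers :: "('d, 's) network \<Rightarrow> 'd \<Rightarrow> 's set" where
  "compatible_servers G d = {u \<in> servers G. (d, u) \<in> edges G}"

definition compatible_dispatchers :: "('d, 's) network \<Rightarrow> 's \<Rightarrow> 'd set" where
  "compatible_dispatchers G u = {d \<in> dispatchers G. (d, u) \<in> edges G}"

definition degree :: "('d, 's) network \<Rightarrow> 'd \<Rightarrow> nat" where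
  "degree G d = card (compatible_servers G d)"

definition alpha_neighborhood ::
  "('d, 's) network \<Rightarrow> ('d \<Rightarrow> real) \<Rightarrow> ('s \<Rightarrow> real) \<Rightarrow> nat \<times> real \<times> real \<Rightarrow> 's \<Rightarrow> 'd set" where
  "alpha_neighborhood G lam mu = (\<lambda>(a, lam_min, mu_max) u.
     {d \<in> compatible_dispatchers G u.
        degree G d \<le> a \<and> lam d \<ge> lam_min \<and> (\<forall>v \<in> compatible_servers G d. mu v \<le> mu_max)})"

definition skewed_neighborhood ::
  "(nat \<Rightarrow> ('d, 's) network) \<Rightarrow> (nat \<Rightarrow> 'd \<Rightarrow> real) \<Rightarrow> (nat \<Rightarrow> 's \<Rightarrow> real) \<Rightarrow> (nat \<Rightarrow> 's) \<Rightarrow> bool" where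
  "skewed_neighborhood G lam mu u \<longleftrightarrow>
     (\<exists>a lam_min mu_max. lam_min > 0 \<and> mu_max > 0 \<and>
        filterlim (\<lambda>n. card (alpha_neighborhood (G n) (lam n) (mu n) (a, lam_min, mu_max) (u n)))
          at_top sequentially)"

section \<open>Continuous-time Markov chains\<close>

text \<open>
  Transition functions on a state space \<open>\<Omega>\<close> whose jump rate from \<open>x\<close> to \<open>y \<noteq> x\<close> is \<open>q x y\<close>:
  as \<open>h\<close> decreases to 0, \<open>p h x y = q x y * h + o(h)\<close> if \<open>y \<noteq> x\<close>, and \<open>p h x x = 1 - q x * h + o(h)\<close>
  where \<open>q x\<close> is the total rate out of \<open>x\<close>. Diagonal values of \<open>q\<close> and negative times are
  irrelevant. When the total rates are bounded in \<open>x\<close>, exactly one such function (on \<open>t \<ge> 0\<close>)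
  exists.
\<close>

definition transition_function ::
  "'x set \<Rightarrow> ('x \<Rightarrow> 'x \<Rightarrow> real) \<Rightarrow> (real \<Rightarrow> 'x \<Rightarrow> 'x \<Rightarrow> real) \<Rightarrow> bool" where
  "transition_function \<Omega> q p \<longleftrightarrow>
     (\<forall>t\<ge>0. \<forall>x\<in>\<Omega>. \<forall>y\<in>\<Omega>. p t x y \<ge> 0) \<and>
     (\<forall>t\<ge>0. \<forall>x\<in>\<Omega>. ((\<lambda>y. p t x y) has_sum 1) \<Omega>) \<and>
     (\<forall>x\<in>\<Omega>. \<forall>y\<in>\<Omega>. p 0 x y = (if y = x then 1 else 0)) \<and>
     (\<forall>s\<ge>0. \<forall>t\<ge>0. \<forall>x\<in>\<Omega>. \<forall>y\<in>\<Omega>. ((\<lambda>z. p s x z * p t z y) has_sum p (s + t) x y) \<Omega>) \<and>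
     (\<forall>x\<in>\<Omega>. q x summable_on (\<Omega> - {x})) \<and>
     (\<forall>x\<in>\<Omega>. \<forall>y\<in>\<Omega>. ((\<lambda>h. p h x y) has_real_derivative
        (if y = x then - (\<Sum>\<^sub>\<infinity>z\<in>\<Omega> - {x}. q x z) else q x y)) (at 0 within {0..}))"

text \<open>
  The Markov property is stated in product form, so that no conditioning on null events occurs.
  The last two clauses are the cadlag property for the discrete topology on \<open>\<Omega>\<close>: paths are
  piecewise constant, with finitely many jumps in bounded time intervals. The law of \<open>X 0\<close> is
  unconstrained.
\<close>

definition markov_chain ::
  "'w measure \<Rightarrow> 'x set \<Rightarrow> ('x \<Rightarrow> 'x \<Rightarrow> real) \<Rightarrow> (real \<Rightarrow> 'w \<Rightarrow> 'x) \<Rightarrow> bool" where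
  "markov_chain M \<Omega> q X \<longleftrightarrow>
     prob_space M \<and>
     (\<forall>t\<ge>0. X t \<in> measurable M (count_space \<Omega>)) \<and>
     (\<exists>p. transition_function \<Omega> q p \<and>
        (\<forall>(m::nat) t x. 0 \<le> t 0 \<longrightarrow> (\<forall>i\<le>m. t i \<le> t (Suc i)) \<longrightarrow> (\<forall>i\<le>Suc m. x i \<in> \<Omega>) \<longrightarrow>
           \<P>(w in M. \<forall>i\<le>Suc m. X (t i) w = x i) =
           \<P>(w in M. \<forall>i\<le>m. X (t i) w = x i) * p (t (Suc m) - t m) (x m) (x (Suc m)))) \<and>
     (AE w in M. \<forall>t\<ge>0. \<forall>\<^sub>F s in at_right t. X s w = X t w) \<and>
     (AE w in M. \<forall>t>0. \<exists>x\<in>\<Omega>. \<forall>\<^sub>F s in at_left t. X s w = x)"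

section \<open>Load balancing processes\<close>

definition states :: "('d, 's) network \<Rightarrow> ('s \<Rightarrow> nat) set" where
  "states G = servers G \<rightarrow>\<^sub>E UNIV"

definition least_loaded :: "('d, 's) network \<Rightarrow> 'd \<Rightarrow> ('s \<Rightarrow> nat) \<Rightarrow> 's set" where
  "least_loaded G d x =
     {u \<in> compatible_servers G d. \<forall>v \<in> compatible_servers G d. x u \<le> x v}"

definition arrival_rate ::
  "('d, 's) network \<Rightarrow> ('d \<Rightarrow> real) \<Rightarrow> ('s \<Rightarrow> nat) \<Rightarrow> 's \<Rightarrow> real" where
  "arrival_rate G lam x u =
     (\<Sum>d\<in>compatible_dispatchers G u.
        lam d / real (card (least_loaded G d x)) * of_bool (u \<in> least_loaded G d x))"

text \<open>For given \<open>x\<close> and \<open>y\<close>, at most one summand below is nonzero.\<close>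

definition jump_rate ::
  "('d, 's) network \<Rightarrow> ('d \<Rightarrow> real) \<Rightarrow> ('s \<Rightarrow> real) \<Rightarrow> ('s \<Rightarrow> nat) \<Rightarrow> ('s \<Rightarrow> nat) \<Rightarrow> real" where
  "jump_rate G lam mu x y =
     (\<Sum>u\<in>servers G.
        arrival_rate G lam x u * of_bool (y = x(u := x u + 1)) +
        mu u * of_bool (x u > 0 \<and> y = x(u := x u - 1)))"

definition load_balancing_process ::
  "('d, 's) network \<Rightarrow> ('d \<Rightarrow> real) \<Rightarrow> ('s \<Rightarrow> real) \<Rightarrow> 'w measure \<Rightarrow>
   (real \<Rightarrow> 'w \<Rightarrow> 's \<Rightarrow> nat) \<Rightarrow> bool" where
  "load_balancing_process G lam mu M X \<longleftrightarrow> markov_chain M (states G) (jump_rate G lam mu) X"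

end

theory Submission
  imports Defs
begin

text \<open>
  The proof is a drift argument that uses neither a coupling nor a stationary distribution. If a
  bounded function \<open>f\<close> of the state satisfies \<open>A f \<le> e + b g - c f\<close>, where \<open>A\<close> is the generator,
  then the forward equation bounds \<open>E f(X t)\<close> by about \<open>(e + b E g(X t)) / c\<close> for large \<open>t\<close>,
  whatever the initial distribution.

  A sunflower argument selects \<open>r\<close> of the dispatchers with skewed parameters, with \<open>r\<close> large, whose
  server sets share a core \<open>C\<close> that contains the given server, and are disjoint outside \<open>C\<close> (the
  petals). By induction on \<open>k\<close>, the expected deficit of \<open>C\<close> below level \<open>k\<close> is \<open>O(1 / r)\<close>: once \<open>C\<close> is
  above level \<open>k\<close>, a dispatcher sends its tasks to its petal until the petal has reached level \<open>k\<close>.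
  Since petals are disjoint, the number of petals with a given deficit concentrates,
  and a positive fraction of the petals is full. Their dispatchers send tasks to \<open>C\<close> at a total
  rate of order \<open>r\<close>, while tasks leave \<open>C\<close> at a bounded rate, so \<open>C\<close> reaches level \<open>k + 1\<close>. All
  test functions are decreasing in the state, so that all other arrivals can be ignored.
\<close>

section \<open>One-sided differential inequalities\<close>

text \<open>For each slope \<open>\<eta> > 0\<close>, the times at which \<open>z\<close> is at most
  the line of slope \<open>\<eta>\<close> through its initial value form a compact set. Before
  \<open>b\<close>, a nonpositive right derivative would keep \<open>z\<close> below the line a
  little longer, so the largest such time is \<open>b\<close>; then \<open>\<eta>\<close> tends to
  0. Right derivatives are what letting the chain run forward provides.\<close>

lemma right_deriv_nonpos_imp_le:
  fixes z :: "real \<Rightarrow> real"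
  assumes ab: "a \<le> b" and cont: "continuous_on {a..b} z"
    and deriv: "\<And>t. a \<le> t \<Longrightarrow> t < b \<Longrightarrow> \<exists>D\<le>0. (z has_real_derivative D) (at_right t)"
  shows "z b \<le> z a"
proof (cases "a = b")
  case False
  hence ab: "a < b" using ab by simp
  have main: "z b \<le> z a + \<eta> * (b - a)" if \<eta>: "\<eta> > 0" for \<eta>
  proof -
    define S where "S = {t\<in>{a..b}. z t - \<eta> * (t - a) \<in> {..z a}}"
    have "closed ({a..b} \<inter> (\<lambda>t. z t - \<eta> * (t - a)) -` {..z a})"
      by (intro continuous_closed_preimage continuous_intros cont)
    hence "closed S" by (simp add: S_def Int_def vimage_def)
    moreover have "bounded S" unfolding S_def by (rule bounded_subset[of "{a..b}"]) auto
    ultimately have "compact S" by (simp add: compact_eq_bounded_closed)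
    moreover have "a \<in> S" using ab by (auto simp: S_def)
    ultimately obtain s where s: "s \<in> S" "\<And>t. t \<in> S \<Longrightarrow> t \<le> s"
      using compact_attains_sup[of S] by blast
    have "s = b"
    proof (rule ccontr)
      assume "s \<noteq> b"
      hence sb: "a \<le> s" "s < b" using s(1) by (auto simp: S_def)
      then obtain D where D: "D \<le> 0" "(z has_real_derivative D) (at_right s)"
        using deriv by blast
      have "((\<lambda>y. (z y - z s) / (y - s)) \<longlongrightarrow> D) (at_right s)"
        using D(2) by (simp add: has_field_derivative_iff)
      hence "\<forall>\<^sub>F y in at_right s. (z y - z s) / (y - s) < \<eta>"
        using D(1) \<eta> by (elim order_tendstoD(2)) auto
      moreover have "\<forall>\<^sub>F y in at_right s. s < y \<and> y < b"
        using sb by (auto simp: eventually_at_right)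
      ultimately have "\<forall>\<^sub>F y in at_right s. y \<in> S \<and> s < y"
      proof eventually_elim
        case (elim y)
        hence "z y - z s \<le> \<eta> * (y - s)" by (simp add: divide_simps split: if_splits)
        thus ?case using s(1) elim sb by (auto simp: S_def algebra_simps)
      qed
      then obtain y where "y \<in> S" "s < y"
        using eventually_happens[of _ "at_right s"] by (auto simp: trivial_limit_at_right_real)
      thus False using s(2) by fastforce
    qed
    thus ?thesis using s(1) by (auto simp: S_def)
  qed
  have "z b \<le> z a + e" if "e > 0" for e
    using main[of "e / (b - a)"] ab that by simp
  thus ?thesis by (rule field_le_epsilon)
qed simp

text \<open>A Gronwall estimate: with the integrating factor \<open>exp (c * t)\<close>, the excess
  of \<open>y\<close> over \<open>B / c\<close> does not grow, so the excess itself decays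
  exponentially whatever its value at \<open>T\<close>. The margin \<open>\<eta>\<close> absorbs the
  remainder.\<close>

lemma right_differential_inequality_bound:
  fixes y :: "real \<Rightarrow> real"
  assumes c: "c > 0" and \<eta>: "\<eta> > 0"
    and cont: "continuous_on {T..} y"
    and deriv: "\<And>t. T \<le> t \<Longrightarrow> \<exists>D\<le>B - c * y t. (y has_real_derivative D) (at_right t)"
  shows "\<forall>\<^sub>F t in at_top. y t \<le> B / c + \<eta>"
proof -
  define z where "z = (\<lambda>t. exp (c * t) * (y t - B / c))"
  have z_le: "z t \<le> z T" if "T \<le> t" for t
  proof (rule right_deriv_nonpos_imp_le[where z = z and a = T and b = t])
    show "continuous_on {T..t} z" unfolding z_def
      by (intro continuous_intros continuous_on_subset[OF cont]) auto
    show "\<exists>D\<le>0. (z has_real_derivative D) (at_right s)" if s: "T \<le> s" "s < t" for s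
    proof -
      obtain D where D: "D \<le> B - c * y s" "(y has_real_derivative D) (at_right s)"
        using deriv s by auto
      have "(z has_real_derivative exp (c * s) * (c * (y s - B / c) + D)) (at_right s)"
        unfolding z_def by (rule derivative_eq_intros D(2) refl | simp add: algebra_simps)+
      moreover have "exp (c * s) * (c * (y s - B / c) + D) \<le> 0"
        using D(1) c by (intro mult_nonneg_nonpos) (auto simp: algebra_simps)
      ultimately show ?thesis by blast
    qed
  qed fact
  have "filterlim (\<lambda>t. c * t) at_top at_top"
    using c by (intro filterlim_tendsto_pos_mult_at_top[OF tendsto_const _ filterlim_ident])
  hence "filterlim (\<lambda>t. - (c * t)) at_bot at_top" by (simp add: filterlim_uminus_at_top)
  hence "((\<lambda>t. z T * exp (- (c * t))) \<longlongrightarrow> z T * 0) at_top"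
    by (intro tendsto_mult[OF tendsto_const] filterlim_compose[OF exp_at_bot])
  hence "\<forall>\<^sub>F t in at_top. z T * exp (- (c * t)) < \<eta>"
    using \<eta> by (intro order_tendstoD(2)) auto
  moreover have "\<forall>\<^sub>F t in at_top. T \<le> t" by (rule eventually_ge_at_top)
  ultimately show ?thesis
  proof eventually_elim
    case (elim t)
    have "y t - B / c = z t * exp (- (c * t))" by (simp add: z_def exp_minus)
    also have "\<dots> \<le> z T * exp (- (c * t))" using z_le elim by (intro mult_right_mono) auto
    finally show ?case using elim by simp
  qed
qed

section \<open>Forward equation\<close>

lemma measurable_count_space_UNIV:
  assumes "Y \<in> measurable M (count_space \<Omega>)"
  shows "Y \<in> measurable M (count_space UNIV)"
  using measurable_compose[OF assms, of "\<lambda>x. x" "count_space UNIV"] by simp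

text \<open>The values of probability zero in \<open>\<Omega>\<close> are taken on a countable union
  of null sets, so almost surely \<open>Y\<close> hits an atom. This is the condition under which
  \<open>Abs_pmf\<close> represents a measure.\<close>

lemma countable_valued_obtain_pmf:
  fixes Y :: "'w \<Rightarrow> 'x"
  assumes "prob_space M" "Y \<in> measurable M (count_space \<Omega>)" "countable \<Omega>"
  obtains P where "measure_pmf P = distr M (count_space UNIV) Y" "set_pmf P \<subseteq> \<Omega>"
proof -
  interpret prob_space M by fact
  have Y: "Y w \<in> \<Omega>" if "w \<in> space M" for w using measurable_space[OF assms(2) that] by simp
  have meas: "Y \<in> measurable M (count_space UNIV)"
    by (rule measurable_count_space_UNIV) fact
  interpret D: prob_space "distr M (count_space UNIV) Y" using meas by (rule prob_space_distr)
  have "AE w in M. measure (distr M (count_space UNIV) Y) {Y w} \<noteq> 0"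
  proof -
    have "AE w in M. \<forall>x\<in>\<Omega>. prob (Y -` {x} \<inter> space M) = 0 \<longrightarrow> Y w \<noteq> x"
      unfolding AE_ball_countable[OF assms(3)]
    proof
      fix x assume "x \<in> \<Omega>"
      have "Y -` {x} \<inter> space M \<in> sets M" using meas by measurable
      hence "prob (Y -` {x} \<inter> space M) = 0 \<Longrightarrow> AE w in M. w \<notin> Y -` {x} \<inter> space M"
        by (simp add: prob_eq_0)
      thus "AE w in M. prob (Y -` {x} \<inter> space M) = 0 \<longrightarrow> Y w \<noteq> x"
        using AE_space by (cases "prob (Y -` {x} \<inter> space M) = 0") auto
    qed
    moreover have "AE w in M. w \<in> space M" by (rule AE_space)
    ultimately show ?thesis
    proof eventually_elim
      case (elim w)
      thus ?case using Y meas by (auto simp: measure_distr)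
    qed
  qed
  hence "distr M (count_space UNIV) Y \<in>
      {M. prob_space M \<and> sets M = UNIV \<and> (AE x in M. measure M {x} \<noteq> 0)}"
    using meas D.prob_space_axioms by (auto simp: AE_distr_iff)
  hence eq: "measure_pmf (Abs_pmf (distr M (count_space UNIV) Y)) = distr M (count_space UNIV) Y"
    by (rule Abs_pmf_inverse)
  have "set_pmf (Abs_pmf (distr M (count_space UNIV) Y)) \<subseteq> \<Omega>"
  proof
    fix x assume "x \<in> set_pmf (Abs_pmf (distr M (count_space UNIV) Y))"
    hence "prob (Y -` {x} \<inter> space M) \<noteq> 0"
      using meas by (simp add: set_pmf_eq pmf.rep_eq eq measure_distr)
    hence "Y -` {x} \<inter> space M \<noteq> {}" by auto
    thus "x \<in> \<Omega>" using Y by auto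
  qed
  with eq that show ?thesis by blast
qed

text \<open>Adding \<open>B\<close> makes \<open>f\<close> nonnegative, where the identity is known
  for \<open>nn_integral\<close>; the shift cancels at the end.\<close>

lemma integral_bind_pmf_bounded:
  fixes f :: "'b \<Rightarrow> real"
  assumes "\<And>x. \<bar>f x\<bar> \<le> B"
  shows "measure_pmf.expectation (bind_pmf P K) f =
    measure_pmf.expectation P (\<lambda>x. measure_pmf.expectation (K x) f)"
proof -
  have int: "integrable (measure_pmf R) f" for R
    using assms by (intro measure_pmf.integrable_const_bound[where B = B]) auto
  have bnd: "\<bar>measure_pmf.expectation R f\<bar> \<le> B" for R
  proof -
    have "\<bar>measure_pmf.expectation R f\<bar> \<le> measure_pmf.expectation R (\<lambda>x. \<bar>f x\<bar>)"
      by (rule integral_abs_bound)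
    also have "\<dots> \<le> measure_pmf.expectation R (\<lambda>x. B)"
      using assms by (intro integral_mono integrable_abs int) auto
    finally show ?thesis by simp
  qed
  have nn: "0 \<le> f x + B" for x using assms[of x] by linarith
  have nn': "0 \<le> measure_pmf.expectation R f + B" for R using bnd[of R] by linarith
  have int': "integrable (measure_pmf R) (\<lambda>x. f x + B)" for R
    by (intro Bochner_Integration.integrable_add int) auto
  have *: "(\<integral>\<^sup>+x. ennreal (f x + B) \<partial>measure_pmf R) = ennreal (measure_pmf.expectation R f + B)" for R
    by (subst nn_integral_eq_integral[OF int']) (use nn int in auto)
  have intK: "integrable P (\<lambda>x. measure_pmf.expectation (K x) f)"
    using bnd by (intro measure_pmf.integrable_const_bound[where B = B]) auto
  have "ennreal (measure_pmf.expectation (bind_pmf P K) f + B) =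
    (\<integral>\<^sup>+x. ennreal (measure_pmf.expectation (K x) f + B) \<partial>measure_pmf P)"
    by (simp add: *[symmetric])
  also have "\<dots> = ennreal (measure_pmf.expectation P (\<lambda>x. measure_pmf.expectation (K x) f) + B)"
    by (subst nn_integral_eq_integral) (use nn' intK in auto)
  finally have "measure_pmf.expectation (bind_pmf P K) f + B =
    measure_pmf.expectation P (\<lambda>x. measure_pmf.expectation (K x) f) + B"
  proof (subst (asm) ennreal_inj)
    show "0 \<le> measure_pmf.expectation P (\<lambda>x. measure_pmf.expectation (K x) f) + B"
    proof -
      have "0 \<le> measure_pmf.expectation P (\<lambda>x. measure_pmf.expectation (K x) f + B)"
        using nn' by (intro integral_nonneg_AE) auto
      thus ?thesis using intK by simp
    qed
  qed (use nn' in auto)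
  thus ?thesis by simp
qed

section \<open>Transition functions and their rates\<close>

lemma transition_function_at_0:
  assumes "transition_function \<Omega> q p" "x \<in> \<Omega>" "y \<in> \<Omega>"
  shows "p 0 x y = (if y = x then 1 else 0)"
  using assms unfolding transition_function_def by blast

lemma transition_function_deriv:
  assumes "transition_function \<Omega> q p" "x \<in> \<Omega>" "y \<in> \<Omega>"
  shows "((\<lambda>h. p h x y) has_real_derivative
    (if y = x then - (\<Sum>\<^sub>\<infinity>z\<in>\<Omega> - {x}. q x z) else q x y)) (at 0 within {0..})"
  using assms unfolding transition_function_def by blast

lemma transition_function_obtain_pmf:
  assumes "transition_function \<Omega> q p" "t \<ge> 0" "x \<in> \<Omega>"
  obtains P where "set_pmf P \<subseteq> \<Omega>" "\<And>y. y \<in> \<Omega> \<Longrightarrow> pmf P y = p t x y"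
proof -
  \<comment> \<open>Values of \<open>p\<close> outside \<open>\<Omega>\<close> are arbitrary, so
    they are replaced by 0.\<close>
  define f where "f = (\<lambda>y. if y \<in> \<Omega> then p t x y else 0)"
  have nn: "p t x y \<ge> 0" if "y \<in> \<Omega>" for y
    using assms that unfolding transition_function_def by blast
  have sum: "((\<lambda>y. p t x y) has_sum 1) \<Omega>"
    using assms unfolding transition_function_def by blast
  hence "(\<lambda>y. norm (p t x y)) summable_on \<Omega>"
    using nn has_sum_imp_summable[OF sum] by (auto cong: summable_on_cong)
  hence abs: "Infinite_Set_Sum.abs_summable_on (\<lambda>y. p t x y) \<Omega>"
    by (simp only: abs_summable_equivalent)
  have f_nn: "0 \<le> f y" for y using nn by (auto simp: f_def)
  have "(\<integral>\<^sup>+y. ennreal (f y) \<partial>count_space UNIV) = (\<integral>\<^sup>+y. ennreal (p t x y) \<partial>count_space \<Omega>)"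
    by (subst nn_integral_count_space_eq[of UNIV \<Omega>]) (auto simp: f_def intro!: nn_integral_cong)
  also have "\<dots> = ennreal (infsetsum (\<lambda>y. p t x y) \<Omega>)"
    using abs nn by (intro nn_integral_conv_infsetsum) auto
  also have "infsetsum (\<lambda>y. p t x y) \<Omega> = infsum (\<lambda>y. p t x y) \<Omega>"
    using abs by (rule infsetsum_infsum)
  also have "\<dots> = 1" using sum by (rule infsumI)
  finally have "(\<integral>\<^sup>+y. ennreal (f y) \<partial>count_space UNIV) = 1" by simp
  hence *: "pmf (embed_pmf f) y = f y" for y using f_nn by (intro pmf_embed_pmf) auto
  show ?thesis
    by (rule that[of "embed_pmf f"]) (auto simp: set_pmf_eq *, auto simp: f_def split: if_splits)
qed

text \<open>The function \<open>1 - p t x x\<close> is subadditive in \<open>t\<close>, because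
  remaining at \<open>x\<close> at both ends of two consecutive intervals is one way of being at
  \<open>x\<close> after their sum. Cutting \<open>t\<close> into ever more equal pieces bounds it
  by \<open>t\<close> times its derivative at 0. The bound holds for all \<open>t\<close>, which
  later supplies both the Lipschitz constant and the dominating function.\<close>

lemma transition_function_holding_bound:
  assumes tf: "transition_function \<Omega> q p" and t: "t \<ge> 0" and x: "x \<in> \<Omega>"
  shows "1 - p t x x \<le> (\<Sum>\<^sub>\<infinity>z\<in>\<Omega> - {x}. q x z) * t"
proof (cases "t = 0")
  case True
  thus ?thesis using tf x by (auto simp: transition_function_def)
next
  case False
  hence t: "t > 0" using t by simp
  define Q where "Q = (\<Sum>\<^sub>\<infinity>z\<in>\<Omega> - {x}. q x z)"
  have nn: "0 \<le> p s y z" if "s \<ge> 0" "y \<in> \<Omega>" "z \<in> \<Omega>" for s y z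
    using tf that by (auto simp: transition_function_def)
  have le1: "p s x x \<le> 1" if "s \<ge> 0" for s
  proof -
    have "((\<lambda>y. p s x y) has_sum 1) \<Omega>" using tf x that by (auto simp: transition_function_def)
    from finite_sum_le_has_sum[OF this, of "{x}"] show ?thesis using nn x that by auto
  qed
  have sub: "1 - p (s + r) x x \<le> (1 - p s x x) + (1 - p r x x)" if "s \<ge> 0" "r \<ge> 0" for s r
  proof -
    have "((\<lambda>z. p s x z * p r z x) has_sum p (s + r) x x) \<Omega>"
      using tf x that by (auto simp: transition_function_def)
    from finite_sum_le_has_sum[OF this, of "{x}"] have "p s x x * p r x x \<le> p (s + r) x x"
      using nn x that by auto
    moreover have "0 \<le> (1 - p s x x) * (1 - p r x x)"
      using le1 that by (intro mult_nonneg_nonneg) auto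
    ultimately show ?thesis by (simp add: algebra_simps)
  qed
  have mult: "1 - p (real n * s) x x \<le> real n * (1 - p s x x)" if "s \<ge> 0" for s n
  proof (induction n)
    case 0
    thus ?case using tf x by (auto simp: transition_function_def)
  next
    case (Suc n)
    have "1 - p (real n * s + s) x x \<le> (1 - p (real n * s) x x) + (1 - p s x x)"
      using that by (intro sub) auto
    thus ?case using Suc by (simp add: algebra_simps)
  qed
  have "((\<lambda>h. p h x x) has_real_derivative - Q) (at 0 within {0..})"
    using tf x by (fastforce simp: transition_function_def Q_def)
  hence "((\<lambda>h. (p h x x - p 0 x x) / (h - 0)) \<longlongrightarrow> - Q) (at 0 within {0..})"
    by (simp add: has_field_derivative_iff)
  moreover have "filterlim (\<lambda>n. t / real (Suc n)) (at 0 within {0..}) sequentially"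
    unfolding filterlim_at using t
    by (auto intro!: tendsto_divide_0[OF tendsto_const] filterlim_at_top_imp_at_infinity
        filterlim_compose[OF filterlim_real_sequentially filterlim_Suc] simp del: of_nat_Suc)
  ultimately have "(\<lambda>n. (p (t / real (Suc n)) x x - p 0 x x) / (t / real (Suc n) - 0)) \<longlonglongrightarrow> - Q"
    by (rule filterlim_compose)
  hence "(\<lambda>n. - t * ((p (t / real (Suc n)) x x - p 0 x x) / (t / real (Suc n) - 0))) \<longlonglongrightarrow> - t * - Q"
    by (intro tendsto_mult tendsto_const)
  moreover have "1 - p t x x \<le> - t * ((p (t / real (Suc n)) x x - p 0 x x) / (t / real (Suc n) - 0))" for n
  proof -
    have "p 0 x x = 1" using tf x by (auto simp: transition_function_def)
    moreover define s where "s = t / real (Suc n)"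
    ultimately have "- t * ((p s x x - p 0 x x) / (s - 0)) = real (Suc n) * (1 - p s x x)"
      using t by (simp add: s_def field_simps del: of_nat_Suc)
    moreover have "real (Suc n) * s = t" by (simp add: s_def del: of_nat_Suc)
    ultimately show ?thesis using mult[of s "Suc n"] t by (simp add: s_def del: of_nat_Suc)
  qed
  ultimately have "1 - p t x x \<le> - t * - Q"
    by (intro LIMSEQ_le_const) auto
  thus ?thesis by (simp add: Q_def algebra_simps)
qed

text \<open>The Markov property for two times, summed over the countably many states at time
  \<open>t\<close>, shows that the law at \<open>t + h\<close> is the law at \<open>t\<close>
  followed by the kernel \<open>K h\<close>. From here on the argument concerns laws rather than
  paths.\<close>

lemma markov_chain_obtain_pmfs:
  assumes mc: "markov_chain M \<Omega> q X" and \<Omega>: "countable \<Omega>"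
  obtains p law K where "transition_function \<Omega> q p"
    and "\<And>t. t \<ge> 0 \<Longrightarrow> measure_pmf (law t) = distr M (count_space UNIV) (X t)"
    and "\<And>t. t \<ge> 0 \<Longrightarrow> set_pmf (law t) \<subseteq> \<Omega>"
    and "\<And>h x. h \<ge> 0 \<Longrightarrow> x \<in> \<Omega> \<Longrightarrow> set_pmf (K h x) \<subseteq> \<Omega>"
    and "\<And>h x y. h \<ge> 0 \<Longrightarrow> x \<in> \<Omega> \<Longrightarrow> y \<in> \<Omega> \<Longrightarrow> pmf (K h x) y = p h x y"
    and "\<And>t h. t \<ge> 0 \<Longrightarrow> h \<ge> 0 \<Longrightarrow> law (t + h) = bind_pmf (law t) (K h)"
proof -
  interpret prob_space M using mc by (simp add: markov_chain_def)
  have X: "X t \<in> measurable M (count_space \<Omega>)" if "t \<ge> 0" for t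
    using mc that by (simp add: markov_chain_def)
  have X_in: "X t w \<in> \<Omega>" if "t \<ge> 0" "w \<in> space M" for t w
    using measurable_space[OF X that(2)] that by simp
  obtain p where tf: "transition_function \<Omega> q p" and
    markov: "\<And>(m::nat) t x. 0 \<le> t 0 \<Longrightarrow> \<forall>i\<le>m. t i \<le> t (Suc i) \<Longrightarrow> \<forall>i\<le>Suc m. x i \<in> \<Omega> \<Longrightarrow>
           \<P>(w in M. \<forall>i\<le>Suc m. X (t i) w = x i) =
           \<P>(w in M. \<forall>i\<le>m. X (t i) w = x i) * p (t (Suc m) - t m) (x m) (x (Suc m))"
    using mc unfolding markov_chain_def by meson
  have two: "\<P>(w in M. X t w = x \<and> X (t + h) w = y) = \<P>(w in M. X t w = x) * p h x y"
    if "t \<ge> 0" "h \<ge> 0" "x \<in> \<Omega>" "y \<in> \<Omega>" for t h x y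
  proof -
    have *: "(\<forall>i\<le>Suc 0. R i) \<longleftrightarrow> R 0 \<and> R 1" for R by (auto simp: le_Suc_eq)
    show ?thesis
      using markov[of "\<lambda>i. if i = 0 then t else t + h" 0 "\<lambda>i. if i = 0 then x else y"] that
      by (simp add: *)
  qed
  have "\<exists>P. measure_pmf P = distr M (count_space UNIV) (X t) \<and> set_pmf P \<subseteq> \<Omega>" if "t \<ge> 0" for t
    using countable_valued_obtain_pmf[OF prob_space_axioms X[OF that] \<Omega>] by metis
  then obtain law where law: "\<And>t. t \<ge> 0 \<Longrightarrow> measure_pmf (law t) = distr M (count_space UNIV) (X t)"
    "\<And>t. t \<ge> 0 \<Longrightarrow> set_pmf (law t) \<subseteq> \<Omega>"
    by metis
  have "\<exists>P. set_pmf P \<subseteq> \<Omega> \<and> (\<forall>y\<in>\<Omega>. pmf P y = p h x y)" if "h \<ge> 0" "x \<in> \<Omega>" for h x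
    using transition_function_obtain_pmf[OF tf that] by metis
  then obtain K where K: "\<And>h x. h \<ge> 0 \<Longrightarrow> x \<in> \<Omega> \<Longrightarrow> set_pmf (K h x) \<subseteq> \<Omega>"
    "\<And>h x y. h \<ge> 0 \<Longrightarrow> x \<in> \<Omega> \<Longrightarrow> y \<in> \<Omega> \<Longrightarrow> pmf (K h x) y = p h x y"
    by metis
  have meas: "X t \<in> measurable M (count_space UNIV)" if "t \<ge> 0" for t
    by (rule measurable_count_space_UNIV[OF X[OF that]])
  have pmf_law: "pmf (law t) x = \<P>(w in M. X t w = x)" if "t \<ge> 0" for t x
  proof -
    have "X t -` {x} \<inter> space M = {w \<in> space M. X t w = x}" by auto
    thus ?thesis using that by (simp add: pmf.rep_eq law(1) measure_distr meas)
  qed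
  have "law (t + h) = bind_pmf (law t) (K h)" if th: "t \<ge> 0" "h \<ge> 0" for t h
  proof (rule pmf_eqI)
    fix y
    show "pmf (law (t + h)) y = pmf (bind_pmf (law t) (K h)) y"
    proof (cases "y \<in> \<Omega>")
      case False
      hence "y \<notin> set_pmf (law (t + h))" using law(2)[of "t + h"] th by auto
      moreover have "y \<notin> set_pmf (bind_pmf (law t) (K h))"
        using False law(2)[of t] K(1)[of h] th by fastforce
      ultimately show ?thesis by (metis set_pmf_iff)
    next
      case True
      have ev: "{w \<in> space M. X t w = x \<and> X (t + h) w = y} \<in> sets M" for x
      proof -
        have "{w \<in> space M. X t w = x \<and> X (t + h) w = y} =
            (X t -` {x} \<inter> space M) \<inter> (X (t + h) -` {y} \<inter> space M)" by auto
        also have "\<dots> \<in> sets M" using th by (intro sets.Int measurable_sets[OF meas]) auto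
        finally show ?thesis .
      qed
      have "{w \<in> space M. X (t + h) w = y} =
          (\<Union>x\<in>\<Omega>. {w \<in> space M. X t w = x \<and> X (t + h) w = y})"
        using X_in th by auto
      hence "ennreal (pmf (law (t + h)) y) =
          emeasure M (\<Union>x\<in>\<Omega>. {w \<in> space M. X t w = x \<and> X (t + h) w = y})"
        using th by (simp add: pmf_law emeasure_eq_measure)
      also have "\<dots> = (\<integral>\<^sup>+x. emeasure M {w \<in> space M. X t w = x \<and> X (t + h) w = y} \<partial>count_space \<Omega>)"
        using ev \<Omega> by (intro emeasure_UN_countable) (auto simp: disjoint_family_on_def)
      also have "\<dots> = (\<integral>\<^sup>+x. ennreal (pmf (law t) x) * ennreal (pmf (K h x) y) \<partial>count_space \<Omega>)"
        using th True
        by (intro nn_integral_cong) (simp add: emeasure_eq_measure two K(2) pmf_law ennreal_mult')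
      also have "\<dots> = (\<integral>\<^sup>+x. ennreal (pmf (law t) x) * ennreal (pmf (K h x) y) \<partial>count_space UNIV)"
        using law(2)[of t] th by (intro nn_integral_count_space_eq) (auto simp: set_pmf_iff)
      also have "\<dots> = ennreal (pmf (bind_pmf (law t) (K h)) y)"
        by (simp add: ennreal_pmf_bind nn_integral_measure_pmf)
      finally show ?thesis by simp
    qed
  qed
  from that[OF tf law K this] show ?thesis .
qed

text \<open>The finite sets \<open>F x\<close> carry all jumps out of \<open>x\<close>, so the
  generator is a finite sum. Uniformly bounded rates make \<open>E f(X t)\<close> Lipschitz in
  \<open>t\<close>, and dominated convergence identifies its right derivative as the expected
  generator. The drift condition then becomes a linear differential inequality.\<close>

lemma markov_chain_drift_bound:
  fixes f g :: "'x \<Rightarrow> real"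
  assumes mc: "markov_chain M \<Omega> q X" and \<Omega>: "countable \<Omega>"
    and F: "\<And>x. x \<in> \<Omega> \<Longrightarrow> finite (F x)" "\<And>x. x \<in> \<Omega> \<Longrightarrow> F x \<subseteq> \<Omega> - {x}"
      "\<And>x y. x \<in> \<Omega> \<Longrightarrow> y \<in> \<Omega> - {x} - F x \<Longrightarrow> q x y = 0"
    and Q: "\<And>x. x \<in> \<Omega> \<Longrightarrow> (\<Sum>y\<in>F x. q x y) \<le> Q"
    and f: "\<And>x. \<bar>f x\<bar> \<le> B" and g: "\<And>x. \<bar>g x\<bar> \<le> B'"
    and pos: "c > 0" "b \<ge> 0" "\<eta> > 0"
    and drift: "\<And>x. x \<in> \<Omega> \<Longrightarrow> (\<Sum>y\<in>F x. q x y * (f y - f x)) \<le> e + b * g x - c * f x"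
    and ev: "\<forall>\<^sub>F t in at_top. (\<integral>w. g (X t w) \<partial>M) \<le> \<epsilon>"
  shows "\<forall>\<^sub>F t in at_top. (\<integral>w. f (X t w) \<partial>M) \<le> (e + b * \<epsilon>) / c + \<eta>"
proof -
  obtain p law K where tf: "transition_function \<Omega> q p"
    and law: "\<And>t. t \<ge> 0 \<Longrightarrow> measure_pmf (law t) = distr M (count_space UNIV) (X t)"
      "\<And>t. t \<ge> 0 \<Longrightarrow> set_pmf (law t) \<subseteq> \<Omega>"
    and K: "\<And>h x. h \<ge> 0 \<Longrightarrow> x \<in> \<Omega> \<Longrightarrow> set_pmf (K h x) \<subseteq> \<Omega>"
      "\<And>h x y. h \<ge> 0 \<Longrightarrow> x \<in> \<Omega> \<Longrightarrow> y \<in> \<Omega> \<Longrightarrow> pmf (K h x) y = p h x y"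
    and bind: "\<And>t h. t \<ge> 0 \<Longrightarrow> h \<ge> 0 \<Longrightarrow> law (t + h) = bind_pmf (law t) (K h)"
    by (rule markov_chain_obtain_pmfs[OF mc \<Omega>]) (rule that; assumption)
  have B: "B \<ge> 0" using f[of undefined] by linarith
  have int: "integrable (measure_pmf R) k" if "\<And>x. \<bar>k x\<bar> \<le> C" for R and k :: "'x \<Rightarrow> real" and C
    using that by (intro measure_pmf.integrable_const_bound[where B = C]) auto
  have E_X: "(\<integral>w. k (X t w) \<partial>M) = measure_pmf.expectation (law t) k" if "t \<ge> 0" for t and k :: "'x \<Rightarrow> real"
  proof -
    have "X t \<in> measurable M (count_space UNIV)"
      using mc that by (intro measurable_count_space_UNIV) (auto simp: markov_chain_def)
    thus ?thesis using that by (simp add: law integral_distr)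
  qed
  \<comment> \<open>\<open>Af\<close> is the generator applied to \<open>f\<close>, and
    \<open>\<Delta> h x\<close> is the mean increment of \<open>f\<close> over time \<open>h\<close>
    from \<open>x\<close>.\<close>
  define Af where "Af = (\<lambda>x. \<Sum>y\<in>F x. q x y * (f y - f x))"
  define \<Delta> where "\<Delta> = (\<lambda>h x. measure_pmf.expectation (K h x) f - f x)"
  have rate: "(\<Sum>\<^sub>\<infinity>z\<in>\<Omega> - {x}. q x z) = (\<Sum>y\<in>F x. q x y)" if x: "x \<in> \<Omega>" for x
  proof -
    have "(\<Sum>\<^sub>\<infinity>z\<in>\<Omega> - {x}. q x z) = (\<Sum>\<^sub>\<infinity>z\<in>F x. q x z)"
      using F x by (intro infsum_cong_neutral) auto
    thus ?thesis using F(1)[OF x] by simp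
  qed
  \<comment> \<open>The sign of \<open>Q\<close> follows from \<open>p 1 x x \<le> 1\<close> through
    the holding bound.\<close>
  have Q0: "0 \<le> Q" if x: "x \<in> \<Omega>" for x
  proof -
    have "p 1 x x \<le> 1" using K(2)[of 1 x x] x by (metis pmf_le_1 zero_le_one)
    hence "0 \<le> 1 - p 1 x x" by simp
    also have "\<dots> \<le> (\<Sum>\<^sub>\<infinity>z\<in>\<Omega> - {x}. q x z) * 1"
      by (rule transition_function_holding_bound[OF tf _ x]) simp
    also have "\<dots> \<le> Q" using rate Q x by simp
    finally show ?thesis .
  qed
  have diff_bound: "\<bar>f y - f x\<bar> \<le> 2 * B" for x y using f[of x] f[of y] by linarith
  have \<Delta>_eq: "\<Delta> h x = measure_pmf.expectation (K h x) (\<lambda>y. f y - f x)" for h x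
    unfolding \<Delta>_def using int[OF f] by simp
  \<comment> \<open>Outside a finite set the mean increment costs at most the oscillation
    \<open>2 * B\<close> times the mass there. It is applied to \<open>{x}\<close> and to
    \<open>x\<close> together with its jump targets.\<close>
  have off: "\<bar>measure_pmf.expectation R (\<lambda>y. (f y - f x) * indicator (- A) y)\<bar>
      \<le> 2 * B * (1 - sum (pmf R) A)" if "finite A" for R A x
  proof -
    have "\<bar>measure_pmf.expectation R (\<lambda>y. (f y - f x) * indicator (- A) y)\<bar>
        \<le> measure_pmf.expectation R (\<lambda>y. \<bar>(f y - f x) * indicator (- A) y\<bar>)"
      by (rule integral_abs_bound)
    also have "\<dots> \<le> measure_pmf.expectation R (\<lambda>y. 2 * B * indicator (- A) y)"
      using diff_bound B
      by (intro integral_mono int[where C = "2 * B"]) (auto simp: indicator_def)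
    also have "\<dots> = 2 * B * measure_pmf.prob R (- A)" by simp
    also have "measure_pmf.prob R (- A) = 1 - sum (pmf R) A"
      using measure_pmf.prob_compl[of A R] that
      by (simp add: Compl_eq_Diff_UNIV measure_measure_pmf_finite)
    finally show ?thesis .
  qed
  have \<Delta>_bound: "\<bar>\<Delta> h x\<bar> \<le> 2 * B * Q * h" if "h \<ge> 0" "x \<in> \<Omega>" for h x
  proof -
    have "\<Delta> h x = measure_pmf.expectation (K h x) (\<lambda>y. (f y - f x) * indicator (- {x}) y)"
      unfolding \<Delta>_eq by (intro Bochner_Integration.integral_cong) (auto simp: indicator_def)
    hence "\<bar>\<Delta> h x\<bar> \<le> 2 * B * (1 - p h x x)"
      using off[of "{x}" "K h x" x] that by (simp add: K)
    also have "1 - p h x x \<le> (\<Sum>\<^sub>\<infinity>z\<in>\<Omega> - {x}. q x z) * h"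
      using that by (intro transition_function_holding_bound[OF tf])
    also have "\<dots> \<le> Q * h" using that Q by (intro mult_right_mono) (auto simp: rate)
    finally show ?thesis using B by (simp add: mult_left_mono mult.assoc)
  qed
  have \<Delta>_lim: "((\<lambda>h. \<Delta> h x / h) \<longlongrightarrow> Af x) (at_right 0)" if x: "x \<in> \<Omega>" for x
  proof -
    have xF: "x \<notin> F x" "finite (F x)" "F x \<subseteq> \<Omega>" using F x by auto
    have at: "at_right 0 \<le> at 0 within {0::real..}" by (intro at_le) auto
    have p_lim: "((\<lambda>h. p h x y / h) \<longlongrightarrow> q x y) (at_right 0)" if y: "y \<in> F x" for y
    proof -
      have "((\<lambda>h. p h x y) has_real_derivative q x y) (at 0 within {0..})" "p 0 x y = 0"
        using transition_function_deriv[OF tf x, of y] transition_function_at_0[OF tf x, of y] y xF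
        by (auto simp: subset_iff split: if_splits)
      thus ?thesis using tendsto_mono[OF at] by (simp add: has_field_derivative_iff)
    qed
    have diag_lim: "((\<lambda>h. (1 - p h x x) / h) \<longlongrightarrow> sum (q x) (F x)) (at_right 0)"
    proof -
      have "((\<lambda>h. p h x x) has_real_derivative - sum (q x) (F x)) (at 0 within {0..})" "p 0 x x = 1"
        using transition_function_deriv[OF tf x x] transition_function_at_0[OF tf x x]
        by (simp_all add: rate[OF x])
      hence "((\<lambda>h. (p h x x - 1) / h) \<longlongrightarrow> - sum (q x) (F x)) (at_right 0)"
        using tendsto_mono[OF at] by (simp add: has_field_derivative_iff)
      from tendsto_minus[OF this] show ?thesis by (simp add: minus_divide_left)
    qed
    \<comment> \<open>The mass leaving \<open>x\<close> and the mass arriving in \<open>F x\<close>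
      grow at the same rate, so what ends up elsewhere is \<open>o(h)\<close>.\<close>
    have "((\<lambda>h. 2 * B * ((1 - p h x x) / h - (\<Sum>y\<in>F x. p h x y / h))) \<longlongrightarrow>
        2 * B * (sum (q x) (F x) - sum (q x) (F x))) (at_right 0)"
      by (intro tendsto_intros diag_lim p_lim)
    hence lim0: "((\<lambda>h. 2 * B * ((1 - p h x x) / h - (\<Sum>y\<in>F x. p h x y / h))) \<longlongrightarrow> 0) (at_right 0)"
      by simp
    have lim1: "((\<lambda>h. \<Sum>y\<in>F x. p h x y / h * (f y - f x)) \<longlongrightarrow> Af x) (at_right 0)"
      unfolding Af_def by (intro tendsto_intros p_lim)
    have split: "\<bar>\<Delta> h x / h - (\<Sum>y\<in>F x. p h x y / h * (f y - f x))\<bar>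
        \<le> 2 * B * ((1 - p h x x) / h - (\<Sum>y\<in>F x. p h x y / h))" if h: "h > 0" for h
    proof -
      define A where "A = insert x (F x)"
      have A: "finite A" using xF by (simp add: A_def)
      have "\<Delta> h x = measure_pmf.expectation (K h x)
          (\<lambda>y. (f y - f x) * indicator A y + (f y - f x) * indicator (- A) y)"
        unfolding \<Delta>_eq by (intro Bochner_Integration.integral_cong) (auto simp: indicator_def)
      also have "\<dots> = measure_pmf.expectation (K h x) (\<lambda>y. (f y - f x) * indicator A y)
          + measure_pmf.expectation (K h x) (\<lambda>y. (f y - f x) * indicator (- A) y)"
        using diff_bound B
        by (intro Bochner_Integration.integral_add int[where C = "2 * B"]) (auto simp: indicator_def)
      also have "measure_pmf.expectation (K h x) (\<lambda>y. (f y - f x) * indicator A y)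
          = (\<Sum>y\<in>A. (f y - f x) * indicator A y * pmf (K h x) y)"
        using A by (intro integral_measure_pmf_real) (auto simp: indicator_def split: if_splits)
      also have "\<dots> = (\<Sum>y\<in>F x. (f y - f x) * indicator A y * pmf (K h x) y)"
        using xF by (simp add: A_def)
      also have "\<dots> = (\<Sum>y\<in>F x. p h x y * (f y - f x))"
        using xF h x by (intro sum.cong) (auto simp: A_def K(2))
      finally have "\<bar>\<Delta> h x - (\<Sum>y\<in>F x. p h x y * (f y - f x))\<bar> \<le> 2 * B * (1 - sum (pmf (K h x)) A)"
        using off[OF A, of "K h x" x] by simp
      also have "sum (pmf (K h x)) A = p h x x + (\<Sum>y\<in>F x. p h x y)"
        using xF h x by (auto simp: A_def K(2) subset_iff intro!: sum.cong)
      finally have "\<bar>\<Delta> h x - (\<Sum>y\<in>F x. p h x y * (f y - f x))\<bar> / h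
          \<le> 2 * B * (1 - (p h x x + (\<Sum>y\<in>F x. p h x y))) / h"
        using h by (intro divide_right_mono) auto
      moreover have "\<Delta> h x / h - (\<Sum>y\<in>F x. p h x y / h * (f y - f x))
          = (\<Delta> h x - (\<Sum>y\<in>F x. p h x y * (f y - f x))) / h"
        by (simp add: diff_divide_distrib sum_divide_distrib)
      moreover have "(1 - p h x x) / h - (\<Sum>y\<in>F x. p h x y / h)
          = (1 - (p h x x + (\<Sum>y\<in>F x. p h x y))) / h"
        by (simp add: diff_divide_distrib add_divide_distrib sum_divide_distrib)
      ultimately show ?thesis using h by (simp only: abs_divide abs_of_pos times_divide_eq_right)
    qed
    have "((\<lambda>h. \<Delta> h x / h - (\<Sum>y\<in>F x. p h x y / h * (f y - f x))) \<longlongrightarrow> 0) (at_right 0)"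
    proof (rule Lim_null_comparison[OF _ lim0])
      show "\<forall>\<^sub>F h in at_right 0. norm (\<Delta> h x / h - (\<Sum>y\<in>F x. p h x y / h * (f y - f x)))
          \<le> 2 * B * ((1 - p h x x) / h - (\<Sum>y\<in>F x. p h x y / h))"
        using eventually_at_right_less[of "0::real"]
        by eventually_elim (use split in \<open>simp only: real_norm_def\<close>)
    qed
    from tendsto_add[OF this lim1] show ?thesis by simp
  qed
  define y where "y = (\<lambda>t. measure_pmf.expectation (law t) f)"
  have E_bound: "\<bar>measure_pmf.expectation R k\<bar> \<le> C" if "\<And>x. x \<in> set_pmf R \<Longrightarrow> \<bar>k x\<bar> \<le> C"
    for R C and k :: "'x \<Rightarrow> real"
  proof -
    have "integrable R (\<lambda>x. \<bar>k x\<bar>)"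
      using that by (intro measure_pmf.integrable_const_bound[where B = C]) (auto simp: AE_measure_pmf_iff)
    hence "measure_pmf.expectation R (\<lambda>x. \<bar>k x\<bar>) \<le> measure_pmf.expectation R (\<lambda>x. C)"
      using that by (intro integral_mono_AE) (auto simp: AE_measure_pmf_iff)
    moreover have "\<bar>measure_pmf.expectation R k\<bar> \<le> measure_pmf.expectation R (\<lambda>x. \<bar>k x\<bar>)"
      by (rule integral_abs_bound)
    moreover have "measure_pmf.expectation R (\<lambda>x. C) = C" by simp
    ultimately show ?thesis by linarith
  qed
  have increment: "y (t + h) - y t = measure_pmf.expectation (law t) (\<Delta> h)" if "t \<ge> 0" "h \<ge> 0" for t h
  proof -
    have "\<bar>measure_pmf.expectation (K h x) f\<bar> \<le> B" for x using f by (intro E_bound)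
    hence "integrable (law t) (\<lambda>x. measure_pmf.expectation (K h x) f)" by (rule int)
    thus ?thesis unfolding y_def \<Delta>_def using that
      by (simp add: bind integral_bind_pmf_bounded[OF f] Bochner_Integration.integral_diff[OF _ int[OF f]])
  qed
  have step: "\<bar>y (t + h) - y t\<bar> \<le> 2 * B * Q * h" if "t \<ge> 0" "h \<ge> 0" for t h
    unfolding increment[OF that] using \<Delta>_bound law(2)[of t] that by (intro E_bound) auto
  have cont: "continuous_on {0..} y"
  proof (rule lipschitz_on_continuous_on)
    obtain x where x: "x \<in> set_pmf (law 0)" using set_pmf_not_empty by fast
    have Q: "0 \<le> Q" using Q0[of x] law(2)[of 0] x by auto
    show "(2 * B * Q)-lipschitz_on {0..} y"
    proof (rule lipschitz_onI)
      fix s t :: real assume "s \<in> {0..}" "t \<in> {0..}"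
      thus "dist (y s) (y t) \<le> 2 * B * Q * dist s t"
        using step[of s "t - s"] step[of t "s - t"] by (cases "s \<le> t") (auto simp: dist_real_def)
    qed (use B Q in auto)
  qed
  have deriv: "(y has_real_derivative measure_pmf.expectation (law t) Af) (at_right t)" if t: "t \<ge> 0" for t
  proof -
    have lim: "((\<lambda>h. measure_pmf.expectation (law t) (\<lambda>x. \<Delta> h x / h)) \<longlongrightarrow>
        measure_pmf.expectation (law t) Af) (at_right 0)"
    \<comment> \<open>Dominated convergence works along sequences; the constant
      \<open>2 * B * Q\<close> dominates by \<open>\<Delta>_bound\<close>.\<close>
    proof (rule tendsto_at_right_sequentially[of 0 1])
      fix S :: "nat \<Rightarrow> real" assume S: "\<And>n. 0 < S n" "S \<longlonglongrightarrow> 0"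
      show "(\<lambda>n. measure_pmf.expectation (law t) (\<lambda>x. \<Delta> (S n) x / S n)) \<longlonglongrightarrow>
        measure_pmf.expectation (law t) Af"
      proof (rule integral_dominated_convergence[where w = "\<lambda>_. 2 * B * Q"])
        have "filterlim S (at_right 0) sequentially"
          using S(2) less_imp_neq[OF S(1), symmetric] S(1) by (simp add: filterlim_at)
        thus "AE x in law t. (\<lambda>n. \<Delta> (S n) x / S n) \<longlonglongrightarrow> Af x"
          using law(2)[OF t] by (auto simp: AE_measure_pmf_iff intro!: filterlim_compose[OF \<Delta>_lim])
        show "AE x in law t. norm (\<Delta> (S n) x / S n) \<le> 2 * B * Q" for n
          unfolding AE_measure_pmf_iff
        proof
          fix x assume "x \<in> set_pmf (law t)"
          hence "\<bar>\<Delta> (S n) x\<bar> \<le> 2 * B * Q * S n" using S(1)[of n] law(2)[OF t] by (intro \<Delta>_bound) auto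
          thus "norm (\<Delta> (S n) x / S n) \<le> 2 * B * Q" using S(1)[of n] by (simp add: field_simps)
        qed
      qed auto
    qed simp
    have "((\<lambda>h. (y (t + h) - y t) / h) \<longlongrightarrow> measure_pmf.expectation (law t) Af) (at_right 0)"
    proof (rule Lim_transform_eventually[OF lim])
      show "\<forall>\<^sub>F h in at_right 0. measure_pmf.expectation (law t) (\<lambda>x. \<Delta> h x / h) = (y (t + h) - y t) / h"
        using eventually_at_right_less[of "0::real"]
        by eventually_elim (use t in \<open>simp add: increment\<close>)
    qed
    thus ?thesis
      unfolding has_field_derivative_iff
      by (subst at_right_to_0) (simp add: filterlim_filtermap add.commute)
  qed
  obtain T where T: "\<And>t. t \<ge> T \<Longrightarrow> (\<integral>w. g (X t w) \<partial>M) \<le> \<epsilon>"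
    using ev by (auto simp: eventually_at_top_linorder)
  \<comment> \<open>The bound on \<open>g\<close> may set in at a negative time, whereas the law is
    controlled only from time 0 on.\<close>
  define T' where "T' = max T 0"
  have "\<forall>\<^sub>F t in at_top. y t \<le> (e + b * \<epsilon>) / c + \<eta>"
  proof (rule right_differential_inequality_bound[where T = T'])
    show "continuous_on {T'..} y" by (rule continuous_on_subset[OF cont]) (auto simp: T'_def)
    show "\<exists>D\<le>(e + b * \<epsilon>) - c * y t. (y has_real_derivative D) (at_right t)" if "T' \<le> t" for t
    proof (intro exI conjI)
      have t: "t \<ge> 0" "t \<ge> T" using that by (auto simp: T'_def)
      show "(y has_real_derivative measure_pmf.expectation (law t) Af) (at_right t)"
        by (rule deriv) fact
      have rhs: "integrable (law t) (\<lambda>x. e + b * g x - c * f x)"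
        using int[OF f] int[OF g] by simp
      have "measure_pmf.expectation (law t) Af \<le> measure_pmf.expectation (law t) (\<lambda>x. e + b * g x - c * f x)"
      proof (rule integral_mono_AE)
        have "\<bar>Af x\<bar> \<le> 2 * B * Q" if "x \<in> \<Omega>" for x
        proof (rule tendsto_upperbound[OF tendsto_rabs[OF \<Delta>_lim[OF that]]])
          show "\<forall>\<^sub>F h in at_right 0. \<bar>\<Delta> h x / h\<bar> \<le> 2 * B * Q"
            using eventually_at_right_less[of "0::real"]
          proof eventually_elim
            case (elim h)
            thus ?case using \<Delta>_bound[of h x] that by (simp add: abs_divide field_simps)
          qed
        qed simp
        thus "integrable (law t) Af"
          using law(2)[OF t(1)]
          by (intro measure_pmf.integrable_const_bound[where B = "2 * B * Q"]) (auto simp: AE_measure_pmf_iff)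
        show "AE x in law t. Af x \<le> e + b * g x - c * f x"
          using law(2)[OF t(1)] drift by (auto simp: AE_measure_pmf_iff Af_def)
      qed (fact rhs)
      also have "\<dots> = e + b * measure_pmf.expectation (law t) g - c * y t"
        using int[OF f] int[OF g] by (simp add: y_def)
      also have "\<dots> \<le> e + b * \<epsilon> - c * y t"
        using T[OF t(2)] pos E_X[OF t(1), of g] by (auto intro!: mult_left_mono)
      finally show "measure_pmf.expectation (law t) Af \<le> e + b * \<epsilon> - c * y t" .
    qed
  qed (use pos in auto)
  moreover have "\<forall>\<^sub>F t::real in at_top. t \<ge> 0" by (rule eventually_ge_at_top)
  ultimately show ?thesis by eventually_elim (simp add: E_X y_def)
qed

section \<open>Sunflowers\<close>

text \<open>The Erdos-Rado argument, by induction on the number \<open>s\<close> of points outside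
  the kernel \<open>C0\<close>. In a largest subfamily that meets pairwise in \<open>C0\<close>
  only, fewer than \<open>r\<close> members leave few points, which all remaining sets must hit; a
  popular point then joins the kernel. The sets are indexed, so equal sets count separately and give
  empty petals. The threshold \<open>F\<close> is independent of the family, which makes it uniform
  over all networks.\<close>

lemma sunflower_lemma:
  fixes r s :: nat
  shows "\<exists>F. \<forall>(N :: 'd \<Rightarrow> 's set) A C0. finite A \<longrightarrow>
    (\<forall>d\<in>A. finite (N d) \<and> C0 \<subseteq> N d \<and> card (N d - C0) \<le> s) \<longrightarrow> F \<le> card A \<longrightarrow>
    (\<exists>R C. R \<subseteq> A \<and> card R = r \<and> C0 \<subseteq> C \<and> (\<forall>d\<in>R. C \<subseteq> N d) \<and>
       (\<forall>d\<in>R. \<forall>e\<in>R. d \<noteq> e \<longrightarrow> N d \<inter> N e = C))"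
proof (induction s)
  case 0
  show ?case
  proof (rule exI[of _ r], intro allI impI)
    fix N :: "'d \<Rightarrow> 's set" and A C0
    assume A: "finite A" and N: "\<forall>d\<in>A. finite (N d) \<and> C0 \<subseteq> N d \<and> card (N d - C0) \<le> 0"
      and r: "r \<le> card A"
    obtain R where "R \<subseteq> A" "card R = r" using r obtain_subset_with_card_n by blast
    moreover have "N d = C0" if "d \<in> A" for d using N that by auto
    ultimately show "\<exists>R C. R \<subseteq> A \<and> card R = r \<and> C0 \<subseteq> C \<and> (\<forall>d\<in>R. C \<subseteq> N d) \<and>
       (\<forall>d\<in>R. \<forall>e\<in>R. d \<noteq> e \<longrightarrow> N d \<inter> N e = C)"
      by (intro exI[of _ R] exI[of _ C0]) auto
  qed
next
  case (Suc s)
  then obtain F where F: "\<forall>(N :: 'd \<Rightarrow> 's set) A C0. finite A \<longrightarrow>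
    (\<forall>d\<in>A. finite (N d) \<and> C0 \<subseteq> N d \<and> card (N d - C0) \<le> s) \<longrightarrow> F \<le> card A \<longrightarrow>
    (\<exists>R C. R \<subseteq> A \<and> card R = r \<and> C0 \<subseteq> C \<and> (\<forall>d\<in>R. C \<subseteq> N d) \<and>
       (\<forall>d\<in>R. \<forall>e\<in>R. d \<noteq> e \<longrightarrow> N d \<inter> N e = C))"
    ..
  show ?case
  \<comment> \<open>Here \<open>r\<close> accounts for the maximal subfamily,
    \<open>r * Suc s\<close> for the points it covers outside \<open>C0\<close>, and
    \<open>F\<close> for the sets through each such point.\<close>
  proof (rule exI[of _ "r + r * Suc s * F + 1"], intro allI impI)
    fix N :: "'d \<Rightarrow> 's set" and A C0
    assume A: "finite A" and N: "\<forall>d\<in>A. finite (N d) \<and> C0 \<subseteq> N d \<and> card (N d - C0) \<le> Suc s"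
      and le: "r + r * Suc s * F + 1 \<le> card A"
    show "\<exists>R C. R \<subseteq> A \<and> card R = r \<and> C0 \<subseteq> C \<and> (\<forall>d\<in>R. C \<subseteq> N d) \<and>
       (\<forall>d\<in>R. \<forall>e\<in>R. d \<noteq> e \<longrightarrow> N d \<inter> N e = C)" (is ?goal)
    proof (rule ccontr)
      assume no: "\<not> ?goal"
      define P where "P = (\<lambda>R. R \<subseteq> A \<and> (\<forall>d\<in>R. \<forall>e\<in>R. d \<noteq> e \<longrightarrow> N d \<inter> N e = C0))"
      have small: "card R < r" if "P R" for R
      proof (rule ccontr)
        assume "\<not> card R < r"
        then obtain R' where R': "R' \<subseteq> R" "card R' = r"
          using obtain_subset_with_card_n[of r R] by auto
        have sub: "R' \<subseteq> A" using R'(1) \<open>P R\<close> unfolding P_def by (meson subset_trans)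
        have ker: "\<forall>d\<in>R'. C0 \<subseteq> N d" using sub N by (meson subsetD)
        have int: "\<forall>d\<in>R'. \<forall>e\<in>R'. d \<noteq> e \<longrightarrow> N d \<inter> N e = C0"
          using R'(1) \<open>P R\<close> unfolding P_def by (meson subsetD)
        have ?goal by (rule exI[of _ R'], rule exI[of _ C0]) (simp add: R'(2) sub ker int)
        thus False using no by simp
      qed
      have "P {}" by (simp add: P_def)
      \<comment> \<open>A subfamily of largest size exists because all sizes stay below
        \<open>r\<close>.\<close>
      then obtain R where R: "P R" and max: "\<And>R'. P R' \<Longrightarrow> card R' \<le> card R"
        using ex_has_greatest_nat[of P "{}" card r] small less_imp_le by metis
      have RA: "R \<subseteq> A" and finR: "finite R" using R A finite_subset by (auto simp: P_def)
      define V where "V = (\<Union>d\<in>R. N d - C0)"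
      have finV: "finite V" using finR N RA by (auto simp: V_def)
      have "card V \<le> (\<Sum>d\<in>R. card (N d - C0))" unfolding V_def by (rule card_UN_le[OF finR])
      also have "\<dots> \<le> (\<Sum>d\<in>R. Suc s)" using N RA by (intro sum_mono) auto
      also have "\<dots> = card R * Suc s" by simp
      also have "\<dots> \<le> r * Suc s" using small[OF R] by (intro mult_right_mono) auto
      finally have cardV: "card V \<le> r * Suc s" .
      \<comment> \<open>By maximality, every further set shares a point outside \<open>C0\<close>
        with some member of \<open>R\<close>.\<close>
      have cover: "A - R \<subseteq> (\<Union>v\<in>V. {d\<in>A. v \<in> N d})"
      proof
        fix d assume d: "d \<in> A - R"
        have "\<not> P (insert d R)"
        proof
          assume "P (insert d R)"
          from max[OF this] show False using d finR by simp
        qed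
        then obtain e where "e \<in> R" "N d \<inter> N e \<noteq> C0"
          using R d by (auto simp: P_def Int_commute)
        then obtain v where "v \<in> N d" "v \<in> N e" "v \<notin> C0" using N RA d by blast
        thus "d \<in> (\<Union>v\<in>V. {d\<in>A. v \<in> N d})" using \<open>e \<in> R\<close> d by (auto simp: V_def)
      qed
      have "\<exists>v\<in>V. F \<le> card {d\<in>A. v \<in> N d}"
      proof (rule ccontr)
        assume "\<not> ?thesis"
        hence "card {d\<in>A. v \<in> N d} \<le> F" if "v \<in> V" for v using that by fastforce
        hence "(\<Sum>v\<in>V. card {d\<in>A. v \<in> N d}) \<le> (\<Sum>v\<in>V. F)" by (intro sum_mono)
        also have "\<dots> \<le> r * Suc s * F" using cardV by simp
        finally have "card (\<Union>v\<in>V. {d\<in>A. v \<in> N d}) \<le> r * Suc s * F"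
          using card_UN_le[OF finV, of "\<lambda>v. {d\<in>A. v \<in> N d}"] by linarith
        moreover have "card (A - R) \<le> card (\<Union>v\<in>V. {d\<in>A. v \<in> N d})"
          using cover finV A by (intro card_mono) auto
        moreover have "card (A - R) = card A - card R" using RA finR by (simp add: card_Diff_subset)
        ultimately show False using small[OF R] le by linarith
      qed
      then obtain v where v: "v \<in> V" "F \<le> card {d\<in>A. v \<in> N d}" by blast
      \<comment> \<open>Moving \<open>v\<close> into the kernel lowers the number of points outside
        it by exactly one, so the induction hypothesis applies.\<close>
      have "\<forall>d\<in>{d\<in>A. v \<in> N d}. finite (N d) \<and> insert v C0 \<subseteq> N d \<and> card (N d - insert v C0) \<le> s"
      proof
        fix d assume d: "d \<in> {d\<in>A. v \<in> N d}"
        have "N d - insert v C0 = (N d - C0) - {v}" by auto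
        moreover have "v \<in> N d - C0" using d v(1) by (auto simp: V_def)
        ultimately have "card (N d - insert v C0) = card (N d - C0) - 1" by simp
        thus "finite (N d) \<and> insert v C0 \<subseteq> N d \<and> card (N d - insert v C0) \<le> s"
          using N d by fastforce
      qed
      from F[THEN spec, THEN spec, THEN spec, THEN mp, THEN mp, THEN mp, OF _ this v(2)] A obtain R' C where R': "R' \<subseteq> {d\<in>A. v \<in> N d}" "card R' = r"
        "insert v C0 \<subseteq> C" "\<forall>d\<in>R'. C \<subseteq> N d" "\<forall>d\<in>R'. \<forall>e\<in>R'. d \<noteq> e \<longrightarrow> N d \<inter> N e = C"
        by auto
      have ?goal
        by (rule exI[of _ R'], rule exI[of _ C], intro conjI R') (use R' in auto)
      thus False using no by simp
    qed
  qed
qed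

section \<open>Generator of the load balancing process\<close>

text \<open>Indexing by servers rather than target states separates arrivals from departures, whose
  contributions are bounded by different arguments.\<close>

definition generator ::
  "('d, 's) network \<Rightarrow> ('d \<Rightarrow> real) \<Rightarrow> ('s \<Rightarrow> real) \<Rightarrow> (('s \<Rightarrow> nat) \<Rightarrow> real) \<Rightarrow> ('s \<Rightarrow> nat) \<Rightarrow> real" where
  "generator G lam mu f x =
     (\<Sum>v\<in>servers G. arrival_rate G lam x v * (f (x(v := x v + 1)) - f x)) +
     (\<Sum>v\<in>servers G. mu v * of_bool (x v > 0) * (f (x(v := x v - 1)) - f x))"

text \<open>These are the finite sets \<open>F x\<close> of the drift bound. Since subtraction
  truncates, \<open>x v > 0\<close> is what keeps \<open>x\<close> itself out.\<close>

definition jump_targets :: "('d, 's) network \<Rightarrow> ('s \<Rightarrow> nat) \<Rightarrow> ('s \<Rightarrow> nat) set" where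
  "jump_targets G x = (\<lambda>v. x(v := x v + 1)) ` servers G \<union>
     (\<lambda>v. x(v := x v - 1)) ` {v \<in> servers G. x v > 0}"

section \<open>Support and total of the jump rates\<close>

lemma countable_states: "is_network G \<Longrightarrow> countable (states G)"
  unfolding states_def is_network_def by (intro countable_PiE) auto

lemma finite_jump_targets: "is_network G \<Longrightarrow> finite (jump_targets G x)"
  by (simp add: jump_targets_def is_network_def)

lemma jump_targets_subset: "x \<in> states G \<Longrightarrow> jump_targets G x \<subseteq> states G - {x}"
  unfolding jump_targets_def states_def
  by (auto simp: PiE_iff extensional_def fun_upd_idem_iff)

lemma jump_rate_eq_0: "y \<notin> jump_targets G x \<Longrightarrow> jump_rate G lam mu x y = 0"
  unfolding jump_rate_def
proof (intro sum.neutral ballI)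
  fix v assume y: "y \<notin> jump_targets G x" and v: "v \<in> servers G"
  have "y \<noteq> x(v := x v + 1)" using y v unfolding jump_targets_def by blast
  moreover have "\<not> (x v > 0 \<and> y = x(v := x v - 1))" using y v unfolding jump_targets_def by blast
  ultimately show "arrival_rate G lam x v * of_bool (y = x(v := x v + 1)) +
      mu v * of_bool (x v > 0 \<and> y = x(v := x v - 1)) = 0" by (simp only: of_bool_eq mult_zero_right add_0)
qed

text \<open>After exchanging the two sums, each indicator in \<open>jump_rate\<close> selects a
  single target state.\<close>

lemma sum_jump_rate:
  fixes k :: "('s \<Rightarrow> nat) \<Rightarrow> real"
  assumes "is_network G"
  shows "(\<Sum>y\<in>jump_targets G x. jump_rate G lam mu x y * k y) =
    (\<Sum>v\<in>servers G. arrival_rate G lam x v * k (x(v := x v + 1))) +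
    (\<Sum>v\<in>servers G. mu v * of_bool (x v > 0) * k (x(v := x v - 1)))"
proof -
  let ?F = "jump_targets G x"
  have fin: "finite ?F" using assms by (rule finite_jump_targets)
  have "(\<Sum>y\<in>?F. jump_rate G lam mu x y * k y) =
      (\<Sum>v\<in>servers G. \<Sum>y\<in>?F. (arrival_rate G lam x v * of_bool (y = x(v := x v + 1)) +
        mu v * of_bool (x v > 0 \<and> y = x(v := x v - 1))) * k y)"
    unfolding jump_rate_def sum_distrib_right by (rule sum.swap)
  also have "\<dots> = (\<Sum>v\<in>servers G. arrival_rate G lam x v * k (x(v := x v + 1)) +
      mu v * of_bool (x v > 0) * k (x(v := x v - 1)))"
  proof (rule sum.cong[OF refl])
    fix v assume v: "v \<in> servers G"
    have "(\<Sum>y\<in>?F. arrival_rate G lam x v * of_bool (y = x(v := x v + 1)) * k y) =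
        (\<Sum>y\<in>?F. if y = x(v := x v + 1) then arrival_rate G lam x v * k y else 0)"
      by (intro sum.cong) auto
    also have "\<dots> = arrival_rate G lam x v * k (x(v := x v + 1))"
      using fin v by (subst sum.delta) (auto simp: jump_targets_def)
    finally have 1: "(\<Sum>y\<in>?F. arrival_rate G lam x v * of_bool (y = x(v := x v + 1)) * k y) =
        arrival_rate G lam x v * k (x(v := x v + 1))" .
    have "(\<Sum>y\<in>?F. mu v * of_bool (x v > 0 \<and> y = x(v := x v - 1)) * k y) =
        (\<Sum>y\<in>?F. if y = x(v := x v - 1) then mu v * of_bool (x v > 0) * k y else 0)"
      by (intro sum.cong) auto
    also have "\<dots> = mu v * of_bool (x v > 0) * k (x(v := x v - 1))"
      using fin v by (subst sum.delta) (auto simp: jump_targets_def)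
    finally have 2: "(\<Sum>y\<in>?F. mu v * of_bool (x v > 0 \<and> y = x(v := x v - 1)) * k y) =
        mu v * of_bool (x v > 0) * k (x(v := x v - 1))" .
    show "(\<Sum>y\<in>?F. (arrival_rate G lam x v * of_bool (y = x(v := x v + 1)) +
        mu v * of_bool (x v > 0 \<and> y = x(v := x v - 1))) * k y) =
        arrival_rate G lam x v * k (x(v := x v + 1)) + mu v * of_bool (x v > 0) * k (x(v := x v - 1))"
      by (simp only: distrib_right sum.distrib 1 2)
  qed
  finally show ?thesis by (simp add: sum.distrib)
qed

text \<open>Incompatible dispatchers contribute 0; with a range that no longer depends on
  \<open>v\<close>, sums over servers and dispatchers can be exchanged.\<close>

lemma arrival_rate_alt:
  assumes "is_network G" "v \<in> servers G"
  shows "arrival_rate G lam x v = (\<Sum>d\<in>dispatchers G.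
    lam d / real (card (least_loaded G d x)) * of_bool (v \<in> least_loaded G d x))"
  unfolding arrival_rate_def using assms
  by (intro sum.mono_neutral_left)
    (auto simp: is_network_def compatible_dispatchers_def least_loaded_def compatible_servers_def)

lemma arrival_rate_le:
  assumes net: "is_network G" "v \<in> servers G" and lam: "\<And>d. d \<in> dispatchers G \<Longrightarrow> lam d > 0"
  shows "arrival_rate G lam x v \<le> sum lam (dispatchers G)"
  unfolding arrival_rate_alt[OF net]
proof (rule sum_mono)
  fix d assume d: "d \<in> dispatchers G"
  show "lam d / real (card (least_loaded G d x)) * of_bool (v \<in> least_loaded G d x) \<le> lam d"
  \<comment> \<open>A dispatcher without compatible servers has no minimizers; division by zero
    makes its term 0.\<close>
  proof (cases "card (least_loaded G d x) = 0")
    case False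
    hence "1 \<le> real (card (least_loaded G d x))" by simp
    thus ?thesis using lam[OF d] by (auto simp: of_bool_def field_simps)
  qed (use lam[OF d] in auto)
qed

text \<open>Passes from the servers' point of view to that of the dispatchers: each spreads its rate
  evenly over its minimizers.\<close>

lemma sum_arrival_rate:
  fixes k :: "'s \<Rightarrow> real"
  assumes "is_network G"
  shows "(\<Sum>v\<in>servers G. arrival_rate G lam x v * k v) =
    (\<Sum>d\<in>dispatchers G. lam d / real (card (least_loaded G d x)) * (\<Sum>v\<in>least_loaded G d x. k v))"
proof -
  have fin: "finite (servers G)" using assms by (simp add: is_network_def)
  have "(\<Sum>v\<in>servers G. arrival_rate G lam x v * k v) =
      (\<Sum>v\<in>servers G. \<Sum>d\<in>dispatchers G.
        lam d / real (card (least_loaded G d x)) * of_bool (v \<in> least_loaded G d x) * k v)"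
    using assms by (intro sum.cong refl) (simp add: arrival_rate_alt sum_distrib_right)
  also have "\<dots> = (\<Sum>d\<in>dispatchers G. \<Sum>v\<in>servers G.
        lam d / real (card (least_loaded G d x)) * of_bool (v \<in> least_loaded G d x) * k v)"
    by (rule sum.swap)
  also have "\<dots> = (\<Sum>d\<in>dispatchers G. \<Sum>v\<in>least_loaded G d x.
        lam d / real (card (least_loaded G d x)) * k v)"
    using fin by (intro sum.cong refl sum.mono_neutral_cong_right)
      (auto simp: least_loaded_def compatible_servers_def)
  finally show ?thesis by (simp add: sum_distrib_left)
qed

lemma load_balancing_drift_bound:
  fixes f g :: "('s \<Rightarrow> nat) \<Rightarrow> real"
  assumes net: "is_network G"
    and lam: "\<And>d. d \<in> dispatchers G \<Longrightarrow> lam d > 0"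
    and mu: "\<And>v. v \<in> servers G \<Longrightarrow> mu v > 0"
    and proc: "load_balancing_process G lam mu M X"
    and f: "\<And>x. \<bar>f x\<bar> \<le> B" and g: "\<And>x. \<bar>g x\<bar> \<le> B'"
    and pos: "c > 0" "b \<ge> 0" "\<eta> > 0"
    and drift: "\<And>x. generator G lam mu f x \<le> e + b * g x - c * f x"
    and ev: "\<forall>\<^sub>F t in at_top. (\<integral>w. g (X t w) \<partial>M) \<le> \<epsilon>"
  shows "\<forall>\<^sub>F t in at_top. (\<integral>w. f (X t w) \<partial>M) \<le> (e + b * \<epsilon>) / c + \<eta>"
proof (rule markov_chain_drift_bound[where F = "jump_targets G" and g = g and f = f])
  show "markov_chain M (states G) (jump_rate G lam mu) X"
    using proc by (simp add: load_balancing_process_def)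
  show "countable (states G)" using net by (rule countable_states)
  show "finite (jump_targets G x)" for x using net by (rule finite_jump_targets)
  show "x \<in> states G \<Longrightarrow> jump_targets G x \<subseteq> states G - {x}" for x by (rule jump_targets_subset)
  show "y \<in> states G - {x} - jump_targets G x \<Longrightarrow> jump_rate G lam mu x y = 0" for x y
    by (simp add: jump_rate_eq_0)
  \<comment> \<open>This bound is crude and depends on the network, which is harmless because it
    does not enter the conclusion.\<close>
  show "sum (jump_rate G lam mu x) (jump_targets G x) \<le>
      (\<Sum>v\<in>servers G. sum lam (dispatchers G)) + (\<Sum>v\<in>servers G. mu v)" for x
  proof -
    have "sum (jump_rate G lam mu x) (jump_targets G x) =
        (\<Sum>v\<in>servers G. arrival_rate G lam x v) + (\<Sum>v\<in>servers G. mu v * of_bool (x v > 0))"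
      using sum_jump_rate[OF net, of lam mu x "\<lambda>_. 1"] by simp
    also have "\<dots> \<le> (\<Sum>v\<in>servers G. sum lam (dispatchers G)) + (\<Sum>v\<in>servers G. mu v)"
      using mu arrival_rate_le[OF net _ lam]
      by (intro add_mono sum_mono) (auto simp: of_bool_def intro: less_imp_le)
    finally show ?thesis .
  qed
  show "(\<Sum>y\<in>jump_targets G x. jump_rate G lam mu x y * (f y - f x)) \<le> e + b * g x - c * f x" for x
    using drift[of x] by (simp add: sum_jump_rate[OF net] generator_def)
qed (use f g pos ev in auto)

section \<open>Sunflowers of dispatchers\<close>

text \<open>The truncated subtraction counts only the servers below level \<open>k\<close>.\<close>

definition deficit :: "nat \<Rightarrow> 's set \<Rightarrow> ('s \<Rightarrow> nat) \<Rightarrow> nat" where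
  "deficit k A x = (\<Sum>v\<in>A. k - x v)"

section \<open>Effect of one jump on the deficit\<close>

lemma deficit_arrival:
  assumes "finite A" "v \<in> A" "x v < k"
  shows "Suc (deficit k A (x(v := x v + 1))) = deficit k A x"
proof -
  have "deficit k A y = (k - y v) + (\<Sum>w\<in>A - {v}. k - y w)" for y
    unfolding deficit_def using assms by (subst sum.remove[of A v]) auto
  thus ?thesis using assms by simp
qed

lemma deficit_arrival_le: "deficit k A (x(v := x v + 1)) \<le> deficit k A x"
  unfolding deficit_def by (intro sum_mono) auto

lemma deficit_upd_notin: "v \<notin> A \<Longrightarrow> deficit k A (x(v := n)) = deficit k A x"
  unfolding deficit_def by (intro sum.cong) auto

lemma deficit_departure_le:
  assumes "finite A"
  shows "deficit k A (x(v := x v - 1)) \<le> Suc (deficit k A x)"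
proof (cases "v \<in> A")
  case True
  have "deficit k A y = (k - y v) + (\<Sum>w\<in>A - {v}. k - y w)" for y
    unfolding deficit_def using assms True by (subst sum.remove[of A v]) auto
  thus ?thesis by simp
qed (simp add: deficit_upd_notin)

lemma deficit_eq_0_iff: "finite A \<Longrightarrow> deficit k A x = 0 \<longleftrightarrow> (\<forall>v\<in>A. k \<le> x v)"
  by (auto simp: deficit_def)

lemma deficit_le: "deficit k A x \<le> card A * k"
proof -
  have "deficit k A x \<le> (\<Sum>v\<in>A. k)" unfolding deficit_def by (intro sum_mono) auto
  thus ?thesis by simp
qed

text \<open>A second-order Taylor bound: the squared positive part has second derivative at most 2.
  With \<open>\<delta>\<close> equal to plus or minus one over the number of petals, the remainders
  add up to a fluctuation of that same order.\<close>

lemma square_shortfall_shift: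
  fixes q s \<delta> :: real
  shows "(max 0 (q - (s + \<delta>)))\<^sup>2 - (max 0 (q - s))\<^sup>2 \<le> - 2 * max 0 (q - s) * \<delta> + \<delta>\<^sup>2"
proof (cases "q - s \<ge> 0")
  case True
  have "(max 0 y)\<^sup>2 \<le> y\<^sup>2" for y :: real by (auto simp: max_def)
  from this[of "q - (s + \<delta>)"]
  have "(max 0 (q - (s + \<delta>)))\<^sup>2 - (q - s)\<^sup>2 \<le> (q - (s + \<delta>))\<^sup>2 - (q - s)\<^sup>2" by linarith
  also have "\<dots> = - 2 * (q - s) * \<delta> + \<delta>\<^sup>2" by (simp add: power2_eq_square algebra_simps)
  finally show ?thesis using True by (simp only: max_absorb2)
next
  case False
  have "(max 0 (q - (s + \<delta>)))\<^sup>2 \<le> \<delta>\<^sup>2"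
  proof -
    have "max 0 (q - (s + \<delta>)) \<le> \<bar>\<delta>\<bar>" using False by (auto simp: max_def)
    from power_mono[OF this, of 2] show ?thesis by simp
  qed
  moreover have "max 0 (q - s) = 0" using False by simp
  ultimately show ?thesis by simp
qed

text \<open>The constants \<open>a\<close>, \<open>l\<close> and \<open>m\<close> bound degrees,
  arrival rates and service rates. The number of dispatchers in \<open>R\<close> stays free, so that
  estimates can be expressed as powers of it with constants that depend on \<open>a\<close>,
  \<open>l\<close>, \<open>m\<close> and the level.\<close>

locale dispatcher_sunflower =
  fixes G :: "('d, 's) network" and lam :: "'d \<Rightarrow> real" and mu :: "'s \<Rightarrow> real"
    and R :: "'d set" and C :: "'s set" and a :: nat and l m :: real
  assumes net: "is_network G"
    and lam_pos: "d \<in> dispatchers G \<Longrightarrow> lam d > 0"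
    and mu_pos: "v \<in> servers G \<Longrightarrow> mu v > 0"
    and l_pos: "l > 0" and m_pos: "m > 0"
    and R_subset: "R \<subseteq> dispatchers G" and R_nonempty: "R \<noteq> {}" and C_nonempty: "C \<noteq> {}"
    and core: "d \<in> R \<Longrightarrow> C \<subseteq> compatible_servers G d"
    and petals: "d \<in> R \<Longrightarrow> e \<in> R \<Longrightarrow> d \<noteq> e \<Longrightarrow> compatible_servers G d \<inter> compatible_servers G e = C"
    and degree_le: "d \<in> R \<Longrightarrow> degree G d \<le> a"
    and lam_ge: "d \<in> R \<Longrightarrow> l \<le> lam d"
    and mu_le: "d \<in> R \<Longrightarrow> v \<in> compatible_servers G d \<Longrightarrow> mu v \<le> m"
begin

abbreviation petal :: "'d \<Rightarrow> 's set" where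
  "petal d \<equiv> compatible_servers G d - C"

text \<open>At \<open>j = 0\<close> these are the dispatchers whose petal has reached level
  \<open>k\<close>; one with an empty petal always belongs.\<close>

definition filled :: "nat \<Rightarrow> nat \<Rightarrow> ('s \<Rightarrow> nat) \<Rightarrow> 'd set" where
  "filled k j x = {d \<in> R. deficit k (petal d) x \<le> j}"

definition fraction :: "nat \<Rightarrow> nat \<Rightarrow> ('s \<Rightarrow> nat) \<Rightarrow> real" where
  "fraction k j x = real (card (filled k j x)) / real (card R)"

text \<open>
  While \<open>C\<close> is above level \<open>k\<close>, a petal of positive deficit loses deficit at rate at least \<open>l\<close>, and
  every petal gains deficit at rate at most \<open>a m\<close>. This gives \<open>level_ratio\<close> as the ratio between the
  lower bounds for the fractions of petals with deficit at most \<open>j\<close> and at most \<open>j + 1\<close>. The deficit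
  is at most \<open>a k\<close>, where the fraction is 1.
\<close>

definition total_rate :: real where "total_rate = l + real a * m"

definition level_ratio :: real where "level_ratio = l / total_rate"

text \<open>The target for the fraction falls geometrically from 1 at \<open>j = a * k\<close> to
  \<open>level_ratio ^ (a * k)\<close> at \<open>j = 0\<close>. Clipping at 0 penalizes only missing
  petals, which makes the shortfall decreasing under arrivals.\<close>

definition shortfall :: "nat \<Rightarrow> nat \<Rightarrow> ('s \<Rightarrow> nat) \<Rightarrow> real" where
  "shortfall k j x = max 0 (level_ratio ^ (a * k - j) - fraction k j x)"

section \<open>Elementary bounds for the sunflower\<close>

lemma finite_servers: "finite (servers G)" and finite_dispatchers: "finite (dispatchers G)"
  using net by (auto simp: is_network_def)

lemma compatible_subset: "compatible_servers G d \<subseteq> servers G"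
  by (auto simp: compatible_servers_def)

lemma finite_compatible: "finite (compatible_servers G d)"
  using finite_subset[OF compatible_subset finite_servers] .

lemma finite_R: "finite R" using finite_subset[OF R_subset finite_dispatchers] .

lemma card_R: "card R > 0" using finite_R R_nonempty by (simp add: card_gt_0_iff)

lemma core_subset: "C \<subseteq> servers G" using R_nonempty core compatible_subset by blast

lemma finite_core: "finite C" using finite_subset[OF core_subset finite_servers] .

lemma card_core: "card C \<le> a"
proof -
  obtain d where d: "d \<in> R" using R_nonempty by blast
  have "card C \<le> degree G d" unfolding degree_def by (intro card_mono finite_compatible core d)
  thus ?thesis using degree_le[OF d] by simp
qed

lemma a_pos: "a > 0"
  using card_core finite_core C_nonempty by (metis card_gt_0_iff less_le_trans)

lemma card_petal: "d \<in> R \<Longrightarrow> card (petal d) \<le> a"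
  using degree_le[of d] card_mono[OF finite_compatible, of "petal d" d] by (simp add: degree_def)

lemma total_rate_pos: "total_rate > 0" using l_pos m_pos by (simp add: total_rate_def add_pos_nonneg)

lemma level_ratio_pos: "level_ratio > 0" and level_ratio_le_1: "level_ratio \<le> 1"
  using l_pos m_pos total_rate_pos by (auto simp: level_ratio_def total_rate_def)

lemma l_eq: "l = total_rate * level_ratio" using total_rate_pos by (simp add: level_ratio_def)

lemma least_loaded_subset: "least_loaded G d x \<subseteq> compatible_servers G d"
  by (auto simp: least_loaded_def)

lemma finite_least_loaded: "finite (least_loaded G d x)"
  using finite_subset[OF least_loaded_subset finite_compatible] .

lemma least_loaded_nonempty:
  assumes "d \<in> R"
  shows "least_loaded G d x \<noteq> {}"
proof -
  have "compatible_servers G d \<noteq> {}" using core[OF assms] C_nonempty by blast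
  then obtain v0 where "v0 \<in> compatible_servers G d" by blast
  from ex_has_least_nat[of "\<lambda>v. v \<in> compatible_servers G d", OF this, of x]
  show ?thesis by (auto simp: least_loaded_def)
qed

lemma card_least_loaded: "d \<in> R \<Longrightarrow> card (least_loaded G d x) > 0"
  using finite_least_loaded least_loaded_nonempty by (simp add: card_gt_0_iff)

lemma card_least_loaded_le: "d \<in> R \<Longrightarrow> card (least_loaded G d x) \<le> a"
  using card_mono[OF finite_compatible least_loaded_subset] degree_le unfolding degree_def
  by (meson le_trans)

text \<open>For nonpositive increments, omitting dispatchers outside \<open>R\<close> and lowering
  the remaining rates to \<open>l\<close> can only raise the sum. Monotonicity of the test functions
  enters here.\<close>

lemma arrival_drift_le:
  fixes k :: "'s \<Rightarrow> real"
  assumes k: "\<And>v. k v \<le> 0"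
  shows "(\<Sum>v\<in>servers G. arrival_rate G lam x v * k v) \<le>
    (\<Sum>d\<in>R. l / real (card (least_loaded G d x)) * (\<Sum>v\<in>least_loaded G d x. k v))"
proof -
  let ?L = "\<lambda>d. real (card (least_loaded G d x))" and ?K = "\<lambda>d. \<Sum>v\<in>least_loaded G d x. k v"
  have K: "?K d \<le> 0" for d using k by (intro sum_nonpos) auto
  have "(\<Sum>v\<in>servers G. arrival_rate G lam x v * k v) = (\<Sum>d\<in>dispatchers G. lam d / ?L d * ?K d)"
    by (rule sum_arrival_rate[OF net])
  also have "\<dots> \<le> (\<Sum>d\<in>R. lam d / ?L d * ?K d)"
  proof -
    have "(\<Sum>d\<in>dispatchers G - R. lam d / ?L d * ?K d) \<le> 0"
    proof (rule sum_nonpos)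
      fix d assume "d \<in> dispatchers G - R"
      thus "lam d / ?L d * ?K d \<le> 0" using lam_pos[of d] by (intro mult_nonneg_nonpos K) auto
    qed
    thus ?thesis using sum.subset_diff[OF R_subset finite_dispatchers, of "\<lambda>d. lam d / ?L d * ?K d"] by simp
  qed
  also have "\<dots> \<le> (\<Sum>d\<in>R. l / ?L d * ?K d)"
    using K lam_ge by (intro sum_mono mult_right_mono_neg divide_right_mono) auto
  finally show ?thesis .
qed

text \<open>If \<open>C\<close> has a server below level \<open>k + 1\<close> and the petal of
  \<open>d\<close> is at level \<open>k\<close>, a minimizer of the load over \<open>C\<close> is a
  minimizer for \<open>d\<close>. It receives tasks from \<open>d\<close> at rate at least
  \<open>l / a\<close>, and each of them lowers the deficit by one. Departures act on at most
  \<open>a\<close> core servers, each at rate at most \<open>m\<close>.\<close>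

lemma drift_core_deficit:
  shows "generator G lam mu (\<lambda>x. real (deficit (Suc k) C x)) x \<le>
    real a * m - of_bool (deficit (Suc k) C x > 0) * (l / real a * real (card (filled k 0 x)))"
proof -
  let ?f = "\<lambda>x. real (deficit (Suc k) C x)"
  let ?\<Delta> = "\<lambda>v. ?f (x(v := x v + 1)) - ?f x"
  have neg: "?\<Delta> v \<le> 0" for v using deficit_arrival_le[of "Suc k" C x v] by simp
  have "(\<Sum>v\<in>servers G. arrival_rate G lam x v * ?\<Delta> v) \<le>
      (\<Sum>d\<in>R. l / real (card (least_loaded G d x)) * (\<Sum>v\<in>least_loaded G d x. ?\<Delta> v))"
    using neg by (rule arrival_drift_le)
  also have "\<dots> \<le> (\<Sum>d\<in>R. - (of_bool (deficit (Suc k) C x > 0 \<and> d \<in> filled k 0 x) * (l / real a)))"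
  proof (rule sum_mono)
    fix d assume d: "d \<in> R"
    let ?L = "real (card (least_loaded G d x))"
    have L: "?L > 0" "?L \<le> real a" using card_least_loaded[OF d, of x] card_least_loaded_le[OF d, of x] by auto
    show "l / ?L * (\<Sum>v\<in>least_loaded G d x. ?\<Delta> v) \<le>
        - (of_bool (deficit (Suc k) C x > 0 \<and> d \<in> filled k 0 x) * (l / real a))"
    proof (cases "deficit (Suc k) C x > 0 \<and> d \<in> filled k 0 x")
      case False
      have "l / ?L * (\<Sum>v\<in>least_loaded G d x. ?\<Delta> v) \<le> 0"
        using neg l_pos by (intro mult_nonneg_nonpos sum_nonpos) auto
      thus ?thesis using False by auto
    next
      case True
      obtain v0 where "v0 \<in> C" using C_nonempty by blast
      from ex_has_least_nat[of "\<lambda>v. v \<in> C", OF this, of x]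
      obtain v where v: "v \<in> C" "\<And>w. w \<in> C \<Longrightarrow> x v \<le> x w" by blast
      obtain w where "w \<in> C" "x w < Suc k"
        using True deficit_eq_0_iff[OF finite_core, of "Suc k" x] by (auto simp: not_le)
      hence xv: "x v < Suc k" using v(2) by fastforce
      have "k \<le> x w" if "w \<in> petal d" for w
        using True that finite_compatible[of d] by (auto simp: filled_def deficit_eq_0_iff)
      hence "x v \<le> x w" if "w \<in> compatible_servers G d" for w
        using v(2) xv that by (cases "w \<in> C") fastforce+
      hence v_LL: "v \<in> least_loaded G d x" using core[OF d] v(1) by (auto simp: least_loaded_def)
      \<comment> \<open>The single minimizer \<open>v\<close> in \<open>C\<close> suffices; the
        other minimizers contribute nonpositive increments.\<close>
      have "(\<Sum>v\<in>least_loaded G d x. ?\<Delta> v) = ?\<Delta> v + (\<Sum>v\<in>least_loaded G d x - {v}. ?\<Delta> v)"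
        by (rule sum.remove[OF finite_least_loaded v_LL])
      also have "\<dots> \<le> -1"
      proof -
        have "?\<Delta> v = -1" using deficit_arrival[of C v x "Suc k"] finite_core v(1) xv by linarith
        moreover have "(\<Sum>v\<in>least_loaded G d x - {v}. ?\<Delta> v) \<le> 0" using neg by (rule sum_nonpos)
        ultimately show ?thesis by linarith
      qed
      finally have "l / ?L * (\<Sum>v\<in>least_loaded G d x. ?\<Delta> v) \<le> l / ?L * (-1)"
        using l_pos L by (intro mult_left_mono) auto
      also have "\<dots> \<le> - (l / real a)" using l_pos L by (simp add: frac_le)
      finally show ?thesis using True by simp
    qed
  qed
  also have "\<dots> = - (of_bool (deficit (Suc k) C x > 0) * (l / real a * real (card (filled k 0 x))))"
  proof -
    have "(\<Sum>d\<in>R. of_bool (d \<in> filled k 0 x)) = real (card (filled k 0 x))"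
      using finite_R by (simp add: filled_def of_bool_def sum.If_cases Int_def)
    hence "(\<Sum>d\<in>R. of_bool (deficit (Suc k) C x > 0) * (of_bool (d \<in> filled k 0 x) * (l / real a)))
        = of_bool (deficit (Suc k) C x > 0) * (real (card (filled k 0 x)) * (l / real a))"
      by (simp only: sum_distrib_left[symmetric] sum_distrib_right[symmetric])
    thus ?thesis by (simp only: sum_negf of_bool_conj mult.assoc) (simp add: mult.commute)
  qed
  finally have arr: "(\<Sum>v\<in>servers G. arrival_rate G lam x v * ?\<Delta> v) \<le>
      - (of_bool (deficit (Suc k) C x > 0) * (l / real a * real (card (filled k 0 x))))" .
  have "(\<Sum>v\<in>servers G. mu v * of_bool (x v > 0) * (?f (x(v := x v - 1)) - ?f x)) =
      (\<Sum>v\<in>C. mu v * of_bool (x v > 0) * (?f (x(v := x v - 1)) - ?f x))"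
    using core_subset finite_servers
    by (intro sum.mono_neutral_right) (auto simp: deficit_upd_notin)
  also have "\<dots> \<le> (\<Sum>v\<in>C. m)"
  proof (rule sum_mono)
    fix v assume v: "v \<in> C"
    obtain d where "d \<in> R" using R_nonempty by blast
    hence mu: "0 < mu v" "mu v \<le> m" using core v core_subset mu_pos mu_le by blast+
    have "?f (x(v := x v - 1)) - ?f x \<le> 1"
      using deficit_departure_le[OF finite_core, of "Suc k" x v] by linarith
    from mult_left_mono[OF this, of "mu v"] have "mu v * (?f (x(v := x v - 1)) - ?f x) \<le> m"
      using mu by linarith
    thus "mu v * of_bool (x v > 0) * (?f (x(v := x v - 1)) - ?f x) \<le> m"
      using m_pos by (cases "x v > 0") auto
  qed
  also have "\<dots> \<le> real a * m" using card_core m_pos by simp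
  finally show ?thesis using arr unfolding generator_def by linarith
qed

section \<open>Concentration of the fraction of filled petals\<close>

lemma finite_filled: "finite (filled k j x)"
  using finite_R by (simp add: filled_def)

lemma card_filled_le: "card (filled k j x) \<le> card R"
  using finite_R by (intro card_mono) (auto simp: filled_def)

lemma fraction_bounds: "0 \<le> fraction k j x" "fraction k j x \<le> 1"
  using card_filled_le[of k j x] card_R by (auto simp: fraction_def)

lemma shortfall_bounds: "0 \<le> shortfall k j x" "shortfall k j x \<le> 1"
  using fraction_bounds[of k j x] power_le_one[of level_ratio "a * k - j"] level_ratio_pos level_ratio_le_1
  by (auto simp: shortfall_def)

lemma fraction_mono: "filled k j x \<subseteq> filled k' j' y \<Longrightarrow> fraction k j x \<le> fraction k' j' y"
  unfolding fraction_def by (intro divide_right_mono) (auto intro!: card_mono finite_filled)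

lemma shortfall_square_mono:
  "fraction k j x + \<delta> \<le> fraction k j y \<Longrightarrow>
    (shortfall k j y)\<^sup>2 - (shortfall k j x)\<^sup>2 \<le> - 2 * shortfall k j x * \<delta> + \<delta>\<^sup>2"
proof -
  let ?q = "level_ratio ^ (a * k - j)"
  assume "fraction k j x + \<delta> \<le> fraction k j y"
  hence "(shortfall k j y)\<^sup>2 \<le> (max 0 (?q - (fraction k j x + \<delta>)))\<^sup>2"
    unfolding shortfall_def by (intro power_mono max.mono) auto
  thus ?thesis using square_shortfall_shift[of ?q "fraction k j x" \<delta>] unfolding shortfall_def by linarith
qed

lemma filled_arrival_subset: "filled k j x \<subseteq> filled k j (x(v := x v + 1))"
  using order_trans[OF deficit_arrival_le] by (fastforce simp: filled_def simp del: One_nat_def add_Suc_right)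

lemma shortfall_square_arrival_le: "(shortfall k j (x(v := x v + 1)))\<^sup>2 \<le> (shortfall k j x)\<^sup>2"
proof -
  from fraction_mono[OF filled_arrival_subset] shortfall_square_mono[of k j x 0 "x(v := x v + 1)"]
  show ?thesis by simp
qed

text \<open>The start of the downward recursion in \<open>j\<close>: a petal has at most
  \<open>a\<close> servers, each lacking at most \<open>k\<close> tasks, so all petals qualify and
  the target is 1.\<close>

lemma shortfall_top: "shortfall k (a * k) x = 0"
proof -
  have "deficit k (petal d) x \<le> a * k" if "d \<in> R" for d
    using deficit_le[of k "petal d" x] card_petal[OF that] by (meson le_trans mult_le_mono1)
  hence "filled k (a * k) x = R" by (auto simp: filled_def)
  thus ?thesis using card_R by (simp add: shortfall_def fraction_def)
qed

text \<open>When \<open>C\<close> is at level \<open>k\<close>, a dispatcher whose petal has deficit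
  \<open>j + 1\<close> finds all its minimizers in the petal and below level \<open>k\<close>. Each
  of its tasks therefore brings a new petal into \<open>filled k j\<close>, and the fraction of such
  dispatchers is the difference of the two fractions.\<close>

lemma drift_shortfall_arrivals:
  "(\<Sum>v\<in>servers G. arrival_rate G lam x v * ((shortfall k j (x(v := x v + 1)))\<^sup>2 - (shortfall k j x)\<^sup>2))
    \<le> - 2 * shortfall k j x * l * (fraction k (Suc j) x - fraction k j x) + l / real (card R)
      + 2 * l * real (deficit k C x)"
proof -
  let ?r = "real (card R)" and ?M = "shortfall k j x"
  let ?\<Delta> = "\<lambda>v. (shortfall k j (x(v := x v + 1)))\<^sup>2 - ?M\<^sup>2"
  let ?E = "{d \<in> R. deficit k (petal d) x = Suc j}"
  have r: "?r > 0" using card_R by simp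
  have neg: "?\<Delta> v \<le> 0" for v using shortfall_square_arrival_le by simp
  have arr: "(\<Sum>v\<in>servers G. arrival_rate G lam x v * ?\<Delta> v) \<le>
      (\<Sum>d\<in>R. l / real (card (least_loaded G d x)) * (\<Sum>v\<in>least_loaded G d x. ?\<Delta> v))" (is "_ \<le> ?A")
    using neg by (rule arrival_drift_le)
  have frac: "fraction k (Suc j) x - fraction k j x = real (card ?E) / ?r"
  proof -
    have "filled k (Suc j) x = filled k j x \<union> ?E" "filled k j x \<inter> ?E = {}" by (auto simp: filled_def)
    hence "card (filled k (Suc j) x) = card (filled k j x) + card ?E"
      using finite_filled finite_R by (simp add: card_Un_disjoint)
    thus ?thesis by (simp add: fraction_def add_divide_distrib)
  qed
  have E_le: "real (card ?E) \<le> ?r" using card_mono[OF finite_R, of ?E] by auto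
  have A_nonpos: "?A \<le> 0" using neg l_pos by (intro sum_nonpos mult_nonneg_nonpos) auto
  show ?thesis
  proof (cases "deficit k C x = 0")
    case False
    \<comment> \<open>When \<open>C\<close> is below level \<open>k\<close>, the arrivals still do
      no harm, and the deficit term, at least \<open>2 * l\<close>, outweighs the negative term of
      the bound.\<close>
    have "?M * l * (fraction k (Suc j) x - fraction k j x) \<le> 1 * l * 1"
      using shortfall_bounds[of k j x] l_pos r E_le unfolding frac
      by (intro mult_mono) auto
    moreover have "2 * l * 1 \<le> 2 * l * real (deficit k C x)" using False l_pos by (intro mult_left_mono) auto
    moreover have "0 \<le> l / ?r" using l_pos r by simp
    ultimately show ?thesis using arr A_nonpos by linarith
  next
    case True
    have "?A \<le> (\<Sum>d\<in>R. of_bool (d \<in> ?E) * (l * (- 2 * ?M * (1 / ?r) + (1 / ?r)\<^sup>2)))"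
    proof (rule sum_mono)
      fix d assume d: "d \<in> R"
      let ?L = "real (card (least_loaded G d x))"
      have L: "?L > 0" using card_least_loaded[OF d, of x] by auto
      show "l / ?L * (\<Sum>v\<in>least_loaded G d x. ?\<Delta> v) \<le>
          of_bool (d \<in> ?E) * (l * (- 2 * ?M * (1 / ?r) + (1 / ?r)\<^sup>2))"
      proof (cases "d \<in> ?E")
        case False
        have "l / ?L * (\<Sum>v\<in>least_loaded G d x. ?\<Delta> v) \<le> 0"
          using neg l_pos by (intro mult_nonneg_nonpos sum_nonpos) auto
        moreover have "of_bool (d \<in> ?E) = (0::real)" using False by (simp only: of_bool_eq)
        ultimately show ?thesis by (simp only: mult_zero_left)
      next
        case E: True
        have "?\<Delta> v \<le> - 2 * ?M * (1 / ?r) + (1 / ?r)\<^sup>2" if v: "v \<in> least_loaded G d x" for v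
        proof -
          have "deficit k (petal d) x \<noteq> 0" using E by simp
          then obtain w where w: "w \<in> petal d" "x w < k"
            using finite_compatible[of d] by (auto simp: deficit_eq_0_iff not_le)
          have "x v \<le> x w" using v w by (auto simp: least_loaded_def)
          hence xv: "x v < k" using w by simp
          have "v \<notin> C" using True xv by (auto simp: deficit_eq_0_iff finite_core)
          hence vp: "v \<in> petal d" using v by (auto simp: least_loaded_def)
          have "deficit k (petal d) (x(v := x v + 1)) = j"
            using deficit_arrival[of "petal d" v x k] finite_compatible[of d] vp xv E by simp
          hence "insert d (filled k j x) \<subseteq> filled k j (x(v := x v + 1))"
            using filled_arrival_subset[of k j x v] d by (simp add: filled_def)
          hence "card (insert d (filled k j x)) \<le> card (filled k j (x(v := x v + 1)))"
            by (intro card_mono finite_filled)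
          moreover have "d \<notin> filled k j x" using E by (simp add: filled_def)
          ultimately have "real (card (filled k j x)) + 1 \<le> real (card (filled k j (x(v := x v + 1))))"
            using finite_filled by simp
          hence "fraction k j x + 1 / ?r \<le> fraction k j (x(v := x v + 1))"
            unfolding fraction_def add_divide_distrib[symmetric] by (intro divide_right_mono) auto
          thus ?thesis by (rule shortfall_square_mono)
        qed
        hence "(\<Sum>v\<in>least_loaded G d x. ?\<Delta> v) \<le> ?L * (- 2 * ?M * (1 / ?r) + (1 / ?r)\<^sup>2)"
          by (intro sum_bounded_above)
        hence "l / ?L * (\<Sum>v\<in>least_loaded G d x. ?\<Delta> v) \<le>
            l / ?L * (?L * (- 2 * ?M * (1 / ?r) + (1 / ?r)\<^sup>2))"
          using l_pos L by (intro mult_left_mono) auto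
        also have "\<dots> = l * (- 2 * ?M * (1 / ?r) + (1 / ?r)\<^sup>2)" using L by simp
        finally show ?thesis using E by simp
      qed
    qed
    also have "\<dots> = real (card ?E) * (l * (- 2 * ?M * (1 / ?r) + (1 / ?r)\<^sup>2))"
    proof -
      have "(\<Sum>d\<in>R. of_bool (d \<in> ?E)) = real (card ?E)"
        using finite_R by (simp add: of_bool_def sum.If_cases Int_def)
      thus ?thesis by (simp only: sum_distrib_right[symmetric])
    qed
    also have "\<dots> = - 2 * ?M * l * (real (card ?E) / ?r) + l / ?r * (real (card ?E) / ?r)"
      by (simp add: power2_eq_square algebra_simps)
    \<comment> \<open>At most \<open>card R\<close> squared increments of size
      \<open>1 / card R\<close> leave an error of order \<open>1 / card R\<close>.\<close>
    also have "\<dots> \<le> - 2 * ?M * l * (real (card ?E) / ?r) + l / ?r * 1"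
      using E_le r l_pos by (intro add_left_mono mult_left_mono) auto
    finally show ?thesis using arr True frac by simp
  qed
qed

text \<open>A departure can remove only a petal with deficit exactly \<open>j\<close> from
  \<open>filled k j\<close>, and only one since petals are disjoint. Such petals together have at
  most \<open>a\<close> servers per dispatcher, served at rate at most \<open>m\<close>.\<close>

lemma drift_shortfall_departures:
  "(\<Sum>v\<in>servers G. mu v * of_bool (x v > 0) * ((shortfall k j (x(v := x v - 1)))\<^sup>2 - (shortfall k j x)\<^sup>2))
    \<le> 2 * shortfall k j x * (real a * m) * fraction k j x + real a * m / real (card R)"
proof -
  let ?r = "real (card R)" and ?M = "shortfall k j x"
  let ?\<Delta> = "\<lambda>v. (shortfall k j (x(v := x v - 1)))\<^sup>2 - ?M\<^sup>2"
  let ?E = "{d \<in> R. deficit k (petal d) x = j}"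
  let ?T = "\<Union>d\<in>?E. petal d"
  let ?b = "2 * ?M * (1 / ?r) + (1 / ?r)\<^sup>2"
  have r: "?r > 0" using card_R by simp
  have b: "?b \<ge> 0" using shortfall_bounds[of k j x] r by simp
  have T: "?T \<subseteq> servers G" "finite ?T"
    using compatible_subset finite_compatible finite_R by auto
  have "mu v * of_bool (x v > 0) * ?\<Delta> v \<le> of_bool (v \<in> ?T) * (m * ?b)" if v: "v \<in> servers G" for v
  proof (cases "v \<in> ?T")
    case False
    have "filled k j x \<subseteq> filled k j (x(v := x v - 1))"
    proof
      fix d assume d: "d \<in> filled k j x"
      show "d \<in> filled k j (x(v := x v - 1))"
      proof (cases "v \<in> petal d")
        case True
        hence "deficit k (petal d) x < j" using False d by (fastforce simp: filled_def)
        thus ?thesis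
          using deficit_departure_le[of "petal d" k x v] finite_compatible[of d] d by (auto simp: filled_def)
      qed (use d in \<open>simp add: filled_def deficit_upd_notin\<close>)
    qed
    from fraction_mono[OF this] shortfall_square_mono[of k j x 0 "x(v := x v - 1)"]
    have "?\<Delta> v \<le> 0" by simp
    hence "mu v * of_bool (x v > 0) * ?\<Delta> v \<le> 0"
      using mu_pos[OF v] by (intro mult_nonneg_nonpos) auto
    moreover have "of_bool (v \<in> ?T) = (0::real)" using False by (simp only: of_bool_eq)
    ultimately show ?thesis by (simp only: mult_zero_left)
  next
    case True
    then obtain d where d: "d \<in> ?E" "v \<in> petal d" by blast
    have "filled k j x - {d} \<subseteq> filled k j (x(v := x v - 1))"
    proof
      fix e assume e: "e \<in> filled k j x - {d}"
      \<comment> \<open>A server common to two dispatchers of \<open>R\<close> lies in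
        \<open>C\<close>, hence in no petal.\<close>
      hence "v \<notin> petal e" using d petals[of d e] by (auto simp: filled_def)
      thus "e \<in> filled k j (x(v := x v - 1))" using e by (simp add: filled_def deficit_upd_notin)
    qed
    hence "card (filled k j x - {d}) \<le> card (filled k j (x(v := x v - 1)))"
      by (intro card_mono finite_filled)
    moreover have "card (filled k j x) \<le> Suc (card (filled k j x - {d}))"
      by (cases "d \<in> filled k j x") (auto simp: finite_filled)
    ultimately have "real (card (filled k j x)) + - 1 \<le> real (card (filled k j (x(v := x v - 1))))" by linarith
    hence "fraction k j x + - 1 / ?r \<le> fraction k j (x(v := x v - 1))"
      unfolding fraction_def add_divide_distrib[symmetric] by (intro divide_right_mono) auto
    from shortfall_square_mono[OF this] have \<Delta>: "?\<Delta> v \<le> ?b" by (simp add: power2_eq_square)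
    have mu: "0 < mu v" "mu v \<le> m" using mu_pos[OF v] mu_le[of d v] d by auto
    have "mu v * of_bool (x v > 0) * ?\<Delta> v \<le> mu v * of_bool (x v > 0) * ?b"
      using \<Delta> mu by (intro mult_left_mono) auto
    also have "\<dots> \<le> m * 1 * ?b" using mu b by (intro mult_right_mono mult_mono) auto
    finally show ?thesis using True by simp
  qed
  hence "(\<Sum>v\<in>servers G. mu v * of_bool (x v > 0) * ?\<Delta> v) \<le> (\<Sum>v\<in>servers G. of_bool (v \<in> ?T) * (m * ?b))"
    by (rule sum_mono)
  also have "\<dots> = (\<Sum>v\<in>?T. m * ?b)"
    using T finite_servers by (intro sum.mono_neutral_cong_right) auto
  also have "\<dots> = real (card ?T) * (m * ?b)" by simp
  also have "\<dots> \<le> (real (card ?E) * real a) * (m * ?b)"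
  proof (rule mult_right_mono)
    have "card ?T \<le> (\<Sum>d\<in>?E. card (petal d))" using finite_R by (intro card_UN_le) auto
    also have "\<dots> \<le> (\<Sum>d\<in>?E. a)" using card_petal by (intro sum_mono) auto
    finally have "card ?T \<le> card ?E * a" by simp
    thus "real (card ?T) \<le> real (card ?E) * real a" by (simp flip: of_nat_mult)
  qed (use b m_pos in auto)
  also have "\<dots> = 2 * ?M * (real a * m) * (real (card ?E) / ?r) + real a * m / ?r * (real (card ?E) / ?r)"
    by (simp add: power2_eq_square algebra_simps)
  also have "\<dots> \<le> 2 * ?M * (real a * m) * fraction k j x + real a * m / ?r * 1"
  proof -
    have "card ?E \<le> card (filled k j x)" by (intro card_mono finite_filled) (auto simp: filled_def)
    hence 1: "real (card ?E) / ?r \<le> fraction k j x"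
      unfolding fraction_def by (intro divide_right_mono) auto
    hence 2: "real (card ?E) / ?r \<le> 1" using fraction_bounds(2)[of k j x] by linarith
    show ?thesis using 1 2 shortfall_bounds[of k j x] m_pos r by (intro add_mono mult_left_mono) auto
  qed
  finally show ?thesis by simp
qed

text \<open>The linear terms combine to \<open>2 * M * (total_rate * U - l * U')\<close>, with
  shortfalls \<open>M\<close>, \<open>M'\<close> and fractions \<open>U\<close>, \<open>U'\<close>
  at \<open>j\<close> and \<open>j + 1\<close>. The geometric targets make the constant parts
  cancel, so the shortfall contracts at rate \<open>total_rate\<close> up to the shortfall at
  \<open>j + 1\<close>, the core deficit and an error of order \<open>1 / card R\<close>.\<close>

lemma drift_shortfall:
  assumes j: "j < a * k"
  shows "generator G lam mu (\<lambda>x. (shortfall k j x)\<^sup>2) x \<le>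
    total_rate / real (card R) + (total_rate * (shortfall k (Suc j) x)\<^sup>2 + 2 * l * real (deficit k C x))
      - total_rate * (shortfall k j x)\<^sup>2"
proof -
  let ?M = "shortfall k j x" and ?M' = "shortfall k (Suc j) x"
  let ?U = "fraction k j x" and ?U' = "fraction k (Suc j) x"
  have total_rate: "total_rate > 0" by (rule total_rate_pos)
  have q: "level_ratio ^ (a * k - j) = level_ratio * level_ratio ^ (a * k - Suc j)"
    using j by (metis Suc_diff_Suc power_Suc)
  have "2 * ?M * (total_rate * ?U - l * ?U') \<le> - total_rate * ?M\<^sup>2 + total_rate * ?M'\<^sup>2"
  proof (cases "?M = 0")
    case False
    hence U: "?U = level_ratio ^ (a * k - j) - ?M" by (simp add: shortfall_def max_def split: if_splits)
    have "?U' \<ge> level_ratio ^ (a * k - Suc j) - ?M'" by (simp add: shortfall_def)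
    hence "level_ratio * ?U' \<ge> level_ratio * (level_ratio ^ (a * k - Suc j) - ?M')" using level_ratio_pos by (intro mult_left_mono) auto
    hence "?U - level_ratio * ?U' \<le> level_ratio * ?M' - ?M" using U q by (simp add: algebra_simps)
    hence "2 * ?M * total_rate * (?U - level_ratio * ?U') \<le> 2 * ?M * total_rate * (level_ratio * ?M' - ?M)"
      using shortfall_bounds[of k j x] total_rate by (intro mult_left_mono) auto
    also have "\<dots> = total_rate * (2 * ?M * (level_ratio * ?M') - 2 * ?M\<^sup>2)" by (simp add: algebra_simps power2_eq_square)
    also have "\<dots> \<le> total_rate * (?M'\<^sup>2 - ?M\<^sup>2)"
    proof (rule mult_left_mono)
      \<comment> \<open>The inequality between products and squares spends one of the two copies of
        \<open>M\<close> squared to decouple \<open>M\<close> from \<open>M'\<close>.\<close>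
      have "2 * ?M * (level_ratio * ?M') \<le> ?M\<^sup>2 + (level_ratio * ?M')\<^sup>2" using sum_squares_bound[of ?M "level_ratio * ?M'"] by simp
      also have "(level_ratio * ?M')\<^sup>2 \<le> ?M'\<^sup>2"
        using level_ratio_pos level_ratio_le_1 shortfall_bounds[of k "Suc j" x] by (intro power_mono mult_left_le_one_le) auto
      finally show "2 * ?M * (level_ratio * ?M') - 2 * ?M\<^sup>2 \<le> ?M'\<^sup>2 - ?M\<^sup>2" by simp
    qed (use total_rate in simp)
    finally have *: "2 * ?M * total_rate * (?U - level_ratio * ?U') \<le> total_rate * (?M'\<^sup>2 - ?M\<^sup>2)" .
    have "2 * ?M * total_rate * (?U - level_ratio * ?U') = 2 * ?M * (total_rate * ?U - total_rate * level_ratio * ?U')" by (simp add: algebra_simps)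
    also have "total_rate * level_ratio = l" by (rule l_eq[symmetric])
    finally have "2 * ?M * (total_rate * ?U - l * ?U') \<le> total_rate * (?M'\<^sup>2 - ?M\<^sup>2)" using * by linarith
    also have "\<dots> = - total_rate * ?M\<^sup>2 + total_rate * ?M'\<^sup>2" by (simp add: algebra_simps)
    finally show ?thesis .
  qed (use total_rate in simp)
  moreover have "generator G lam mu (\<lambda>x. (shortfall k j x)\<^sup>2) x \<le>
      (- 2 * ?M * l * (?U' - ?U) + l / real (card R) + 2 * l * real (deficit k C x)) +
      (2 * ?M * (real a * m) * ?U + real a * m / real (card R))"
    unfolding generator_def by (intro add_mono drift_shortfall_arrivals drift_shortfall_departures)
  moreover have "total_rate / real (card R) = l / real (card R) + real a * m / real (card R)"
    by (simp add: total_rate_def add_divide_distrib)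
  moreover have "2 * ?M * (total_rate * ?U - l * ?U') = - 2 * ?M * l * (?U' - ?U) + 2 * ?M * (real a * m) * ?U"
    by (simp add: total_rate_def algebra_simps)
  ultimately show ?thesis by linarith
qed

end

section \<open>Induction on the level\<close>

text \<open>The numerator in the bound for the expected core deficit, obtained by passing one level
  through the drift bounds. It depends on no network and no sunflower, so the sunflower size can be
  chosen after it. The local \<open>q\<close> is \<open>level_ratio ^ (a * k)\<close>, and the final
  \<open>1\<close> pays for the margin \<open>\<eta> = 1 / card R\<close>.\<close>

primrec deficit_const :: "nat \<Rightarrow> real \<Rightarrow> real \<Rightarrow> nat \<Rightarrow> real" where
  "deficit_const a l m 0 = 0"
| "deficit_const a l m (Suc k) =
    (let q = (l / (l + real a * m)) ^ (a * k)
     in 2 * real a * real (a * Suc k) / (l * q) *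
       (real a * m + 2 * l / (real a * q) * (real (a * k) * (2 * deficit_const a l m k + 2))) + 1)"

locale sunflower_process = dispatcher_sunflower G lam mu R C a l m
  for G :: "('d, 's) network" and lam mu R C a l m +
  fixes M :: "'w measure" and X :: "real \<Rightarrow> 'w \<Rightarrow> 's \<Rightarrow> nat"
  assumes proc: "load_balancing_process G lam mu M X"
begin

section \<open>Integrability of the test functions along the process\<close>

lemma X_measurable: "t \<ge> 0 \<Longrightarrow> X t \<in> measurable M (count_space UNIV)"
  using proc unfolding load_balancing_process_def markov_chain_def
  by (intro measurable_count_space_UNIV) blast

sublocale prob_space M
  using proc by (simp add: load_balancing_process_def markov_chain_def)

lemma integrable_bounded:
  fixes f :: "('s \<Rightarrow> nat) \<Rightarrow> real"
  assumes "t \<ge> 0" "\<And>x. \<bar>f x\<bar> \<le> B"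
  shows "integrable M (\<lambda>w. f (X t w))"
  using assms by (intro integrable_const_bound[where B = B] measurable_compose[OF X_measurable]) auto

lemma abs_shortfall_square_le: "\<bar>(shortfall k j x)\<^sup>2\<bar> \<le> 1"
  using power_le_one[OF shortfall_bounds, of k j x 2] by simp

lemma abs_deficit_le: "\<bar>real (deficit k C x)\<bar> \<le> real (a * k)"
  using deficit_le[of k C x] mult_le_mono1[OF card_core, of k] le_trans by (metis abs_of_nat of_nat_mono)

lemma deficit_const_nonneg: "deficit_const a l m k \<ge> 0"
proof (induction k)
  case (Suc k)
  thus ?case using l_pos m_pos by (auto simp: Let_def intro!: add_nonneg_nonneg mult_nonneg_nonneg)
qed simp

text \<open>The induction descends from the threshold \<open>a * k\<close>, where the shortfall
  vanishes. Each step costs \<open>1 / card R\<close> for the drift error, the same for the margin,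
  and at most \<open>2 * B / card R\<close> for the core deficit because
  \<open>level_ratio \<le> 1\<close>.\<close>

lemma eventually_shortfall_le:
  assumes B: "B \<ge> 0" and ev: "\<forall>\<^sub>F t in at_top. (\<integral>w. real (deficit k C (X t w)) \<partial>M) \<le> B / real (card R)"
    and i: "i \<le> a * k"
  shows "\<forall>\<^sub>F t in at_top. (\<integral>w. (shortfall k (a * k - i) (X t w))\<^sup>2 \<partial>M) \<le> real i * (2 * B + 2) / real (card R)"
  using i
proof (induction i)
  case 0
  show ?case by (simp add: shortfall_top)
next
  case (Suc i)
  let ?r = "real (card R)"
  define j where "j = a * k - Suc i"
  have j: "j < a * k" "Suc j = a * k - i" using Suc.prems by (auto simp: j_def)
  define \<epsilon> where "\<epsilon> = total_rate * (real i * (2 * B + 2) / ?r) + 2 * l * (B / ?r)"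
  define g where "g = (\<lambda>x. total_rate * (shortfall k (Suc j) x)\<^sup>2 + 2 * l * real (deficit k C x))"
  have r: "?r > 0" using card_R by simp
  have "\<forall>\<^sub>F t in at_top. (\<integral>w. (shortfall k j (X t w))\<^sup>2 \<partial>M) \<le> (total_rate / ?r + 1 * \<epsilon>) / total_rate + 1 / ?r"
  proof (rule load_balancing_drift_bound[OF net lam_pos mu_pos proc, where g = g])
    show "\<bar>(shortfall k j x)\<^sup>2\<bar> \<le> 1" for x by (rule abs_shortfall_square_le)
    show "\<bar>g x\<bar> \<le> total_rate * 1 + 2 * l * real (a * k)" for x
    proof -
      have "total_rate * (shortfall k (Suc j) x)\<^sup>2 \<le> total_rate * 1" "2 * l * real (deficit k C x) \<le> 2 * l * real (a * k)"
        using abs_shortfall_square_le[of k "Suc j" x] abs_deficit_le[of k x] total_rate_pos l_pos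
        by (intro mult_left_mono; simp)+
      moreover have "0 \<le> g x" using total_rate_pos l_pos by (simp add: g_def)
      ultimately show ?thesis by (simp add: g_def)
    qed
    show "generator G lam mu (\<lambda>x. (shortfall k j x)\<^sup>2) x \<le> total_rate / ?r + 1 * g x - total_rate * (shortfall k j x)\<^sup>2" for x
      using drift_shortfall[OF j(1), of x] by (simp add: g_def)
    have "\<forall>\<^sub>F t in at_top. (\<integral>w. (shortfall k (Suc j) (X t w))\<^sup>2 \<partial>M) \<le> real i * (2 * B + 2) / ?r"
      using Suc by (simp add: j(2))
    with ev show "\<forall>\<^sub>F t in at_top. (\<integral>w. g (X t w) \<partial>M) \<le> \<epsilon>"
      using eventually_ge_at_top[of 0]
    proof eventually_elim
      case (elim t)
      have int: "integrable M (\<lambda>w. (shortfall k (Suc j) (X t w))\<^sup>2)"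
        "integrable M (\<lambda>w. real (deficit k C (X t w)))"
        by (rule integrable_bounded[OF elim(3) abs_shortfall_square_le]
            integrable_bounded[OF elim(3) abs_deficit_le])+
      have "(\<integral>w. g (X t w) \<partial>M) =
          total_rate * (\<integral>w. (shortfall k (Suc j) (X t w))\<^sup>2 \<partial>M) + 2 * l * (\<integral>w. real (deficit k C (X t w)) \<partial>M)"
        unfolding g_def
        using int by simp
      also have "\<dots> \<le> \<epsilon>" unfolding \<epsilon>_def
        using elim total_rate_pos l_pos by (intro add_mono mult_left_mono) auto
      finally show ?case .
    qed
  qed (use total_rate_pos r in auto)
  moreover have "(total_rate / ?r + 1 * \<epsilon>) / total_rate + 1 / ?r \<le> real (Suc i) * (2 * B + 2) / ?r"
  proof -
    have "(total_rate / ?r + 1 * \<epsilon>) / total_rate + 1 / ?r = (2 + real i * (2 * B + 2) + 2 * level_ratio * B) / ?r"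
      using total_rate_pos r by (simp add: \<epsilon>_def level_ratio_def field_simps)
    also have "\<dots> \<le> (2 + real i * (2 * B + 2) + 2 * 1 * B) / ?r"
      using B level_ratio_le_1 r by (intro divide_right_mono add_left_mono mult_right_mono) auto
    finally show ?thesis by (simp add: algebra_simps)
  qed
  ultimately show ?case unfolding j_def[symmetric] by (auto elim: eventually_mono)
qed

text \<open>The count of filled petals is at least half its target up to a multiple of the squared
  shortfall. The indicator of a positive deficit is replaced by the deficit divided by its maximum
  \<open>a * Suc k\<close>, which turns the drift into a linear contraction.\<close>

lemma drift_core_deficit_shortfall:
  fixes k :: nat and q :: real
  defines "q \<equiv> level_ratio ^ (a * k)"
  shows "generator G lam mu (\<lambda>x. real (deficit (Suc k) C x)) x \<le>
    real a * m + 2 * l * real (card R) / (real a * q) * (shortfall k 0 x)\<^sup>2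
      - l * real (card R) * q / (2 * real a * real (a * Suc k)) * real (deficit (Suc k) C x)"
proof -
  let ?r = "real (card R)" and ?M = "shortfall k 0 x" and ?D = "deficit (Suc k) C x"
  have pos: "?r > 0" "q > 0" "real a > 0" using card_R level_ratio_pos a_pos by (auto simp: q_def)
  have filled: "real (card (filled k 0 x)) = ?r * fraction k 0 x"
    using card_R by (simp add: fraction_def)
  have "?M \<ge> q - fraction k 0 x" by (simp add: shortfall_def q_def)
  moreover have "q / 2 + 2 * ?M\<^sup>2 / q \<ge> ?M"
  proof -
    \<comment> \<open>Expanding these squares and dividing by \<open>q\<close> yields the linear
      estimate of \<open>M\<close> by its square.\<close>
    have "0 \<le> (q - 2 * ?M)\<^sup>2 + q\<^sup>2 + 4 * ?M\<^sup>2" by simp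
    hence "4 * (?M * q) \<le> 4 * (q * q / 2 + 2 * ?M\<^sup>2)" by (simp add: power2_eq_square algebra_simps)
    hence "?M * q \<le> (q / 2 + 2 * ?M\<^sup>2 / q) * q" using pos by (simp add: algebra_simps)
    thus ?thesis using pos by simp
  qed
  ultimately have frac: "q / 2 - 2 * ?M\<^sup>2 / q \<le> fraction k 0 x" by linarith
  have nonneg: "0 \<le> 2 * l * ?r / (real a * q) * ?M\<^sup>2" using pos l_pos by simp
  show ?thesis
  proof (cases "?D = 0")
    case True
    thus ?thesis using drift_core_deficit[of k x] nonneg by simp
  next
    case False
    have "l / real a * (?r * (q / 2 - 2 * ?M\<^sup>2 / q)) \<le> l / real a * real (card (filled k 0 x))"
      unfolding filled using frac pos l_pos by (intro mult_left_mono) auto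
    moreover have "l / real a * (?r * (q / 2 - 2 * ?M\<^sup>2 / q)) =
        l * ?r * q / (2 * real a) - 2 * l * ?r / (real a * q) * ?M\<^sup>2"
      using pos by (simp add: field_simps)
    moreover have "l * ?r * q / (2 * real a * real (a * Suc k)) * real ?D \<le>
        l * ?r * q / (2 * real a * real (a * Suc k)) * real (a * Suc k)"
      using abs_deficit_le[of "Suc k" x] pos l_pos by (intro mult_left_mono) auto
    moreover have "l * ?r * q / (2 * real a * real (a * Suc k)) * real (a * Suc k) = l * ?r * q / (2 * real a)"
      using a_pos by (simp del: of_nat_mult of_nat_Suc mult_Suc_right)
    ultimately show ?thesis using drift_core_deficit[of k x] False by simp
  qed
qed

text \<open>The contraction rate \<open>c\<close> is proportional to the number of petals, while the
  outflow \<open>a * m\<close> is not. The coefficient of the squared shortfall also grows with that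
  number, but its expectation is of the inverse order by the previous level, so the quotient is
  \<open>O(1 / card R)\<close>.\<close>

lemma eventually_deficit_le:
  "\<forall>\<^sub>F t in at_top. (\<integral>w. real (deficit k C (X t w)) \<partial>M) \<le> deficit_const a l m k / real (card R)"
proof (induction k)
  case 0
  show ?case by (simp add: deficit_def)
next
  case (Suc k)
  let ?r = "real (card R)" and ?B = "deficit_const a l m k"
  define q where "q = level_ratio ^ (a * k)"
  define \<epsilon> where "\<epsilon> = real (a * k) * (2 * ?B + 2) / ?r"
  define c where "c = l * ?r * q / (2 * real a * real (a * Suc k))"
  have pos: "?r > 0" "q > 0" "real a > 0" "real (a * Suc k) > 0"
    using card_R level_ratio_pos a_pos by (auto simp: q_def simp del: of_nat_mult of_nat_Suc mult_Suc_right)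
  have "\<forall>\<^sub>F t in at_top. (\<integral>w. real (deficit (Suc k) C (X t w)) \<partial>M) \<le>
      (real a * m + 2 * l * ?r / (real a * q) * \<epsilon>) / c + 1 / ?r"
  proof (rule load_balancing_drift_bound[OF net lam_pos mu_pos proc, where g = "\<lambda>x. (shortfall k 0 x)\<^sup>2"])
    show "\<bar>real (deficit (Suc k) C x)\<bar> \<le> real (a * Suc k)" for x by (rule abs_deficit_le)
    show "\<bar>(shortfall k 0 x)\<^sup>2\<bar> \<le> 1" for x by (rule abs_shortfall_square_le)
    show "generator G lam mu (\<lambda>x. real (deficit (Suc k) C x)) x \<le>
        real a * m + 2 * l * ?r / (real a * q) * (shortfall k 0 x)\<^sup>2 - c * real (deficit (Suc k) C x)" for x
      using drift_core_deficit_shortfall[of k x] by (simp only: q_def c_def)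
    show "\<forall>\<^sub>F t in at_top. (\<integral>w. (shortfall k 0 (X t w))\<^sup>2 \<partial>M) \<le> \<epsilon>"
      using eventually_shortfall_le[OF deficit_const_nonneg Suc, of "a * k"] by (simp add: \<epsilon>_def)
    show "0 < c" using pos l_pos by (simp add: c_def)
    show "0 \<le> 2 * l * ?r / (real a * q)" "0 < 1 / ?r" using pos l_pos by simp_all
  qed
  moreover have "(real a * m + 2 * l * ?r / (real a * q) * \<epsilon>) / c + 1 / ?r = deficit_const a l m (Suc k) / ?r"
  proof -
    define Y where "Y = real (a * k) * (2 * ?B + 2)"
    define Z where "Z = real (a * Suc k)"
    have Z: "Z > 0" using pos(4) by (simp add: Z_def)
    have \<epsilon>: "\<epsilon> = Y / ?r" by (simp only: \<epsilon>_def Y_def)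
    have c: "c = l * ?r * q / (2 * real a * Z)" by (simp only: c_def Z_def)
    have "(real a * m + 2 * l * ?r / (real a * q) * \<epsilon>) / c + 1 / ?r =
        (2 * real a * Z / (l * q) * (real a * m + 2 * l / (real a * q) * Y) + 1) / ?r"
      unfolding \<epsilon> c using pos(1-3) Z l_pos by (simp add: field_simps)
    also have "2 * real a * Z / (l * q) * (real a * m + 2 * l / (real a * q) * Y) + 1 = deficit_const a l m (Suc k)"
      by (simp only: deficit_const.simps Let_def Y_def Z_def q_def level_ratio_def total_rate_def)
    finally show ?thesis .
  qed
  ultimately show ?case by simp
qed

text \<open>Markov's inequality: a load below \<open>k\<close> at \<open>u\<close> forces the
  integer-valued deficit of \<open>C\<close> to be at least 1.\<close>

lemma eventually_prob_ge:
  assumes u: "u \<in> C"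
  shows "\<forall>\<^sub>F t in at_top. 1 - deficit_const a l m k / real (card R) \<le> \<P>(w in M. X t w u \<ge> k)"
  using eventually_deficit_le[of k] eventually_ge_at_top[of 0]
proof eventually_elim
  case (elim t)
  let ?A = "{w \<in> space M. X t w u \<ge> k}"
  have A: "?A \<in> sets M"
    using measurable_sets[OF X_measurable[OF elim(2)], of "{x. k \<le> x u}"] by (simp add: vimage_def Int_def conj_commute)
  have compl: "space M - ?A \<in> sets M" using A by (rule sets.compl_sets)
  have "prob (space M - ?A) = prob ((space M - ?A) \<inter> space M)" by (simp only: Int_absorb2[OF Diff_subset])
  also have "\<dots> = (\<integral>w. indicator (space M - ?A) w \<partial>M)"
    by (rule Bochner_Integration.integral_indicator[symmetric])
  also have "\<dots> \<le> (\<integral>w. real (deficit k C (X t w)) \<partial>M)"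
  proof (rule integral_mono)
    show "integrable M (indicator (space M - ?A) :: 'w \<Rightarrow> real)"
      by (rule integrable_real_indicator[OF compl]) (simp add: emeasure_eq_measure)
    show "integrable M (\<lambda>w. real (deficit k C (X t w)))" by (rule integrable_bounded[OF elim(2) abs_deficit_le])
    show "indicator (space M - ?A) w \<le> real (deficit k C (X t w))" for w
    proof (cases "w \<in> space M - ?A")
      case True
      hence "deficit k C (X t w) \<noteq> 0" using u finite_core by (auto simp: deficit_eq_0_iff not_le)
      thus ?thesis using True by simp
    qed simp
  qed
  finally show ?case using elim(1) prob_compl[OF A] by linarith
qed

end

section \<open>Passage to the limit over networks\<close>

theorem theorem1:
  fixes G :: "nat \<Rightarrow> ('d, 's) network"
    and lam :: "nat \<Rightarrow> 'd \<Rightarrow> real"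
    and mu :: "nat \<Rightarrow> 's \<Rightarrow> real"
    and M :: "nat \<Rightarrow> 'w measure"
    and X :: "nat \<Rightarrow> real \<Rightarrow> 'w \<Rightarrow> 's \<Rightarrow> nat"
    and u :: "nat \<Rightarrow> 's"
  assumes "\<And>n. n \<ge> 1 \<Longrightarrow> is_network (G n)"
    and "\<And>n d. n \<ge> 1 \<Longrightarrow> d \<in> dispatchers (G n) \<Longrightarrow> lam n d > 0"
    and "\<And>n v. n \<ge> 1 \<Longrightarrow> v \<in> servers (G n) \<Longrightarrow> mu n v > 0"
    and "\<And>n. n \<ge> 1 \<Longrightarrow> load_balancing_process (G n) (lam n) (mu n) (M n) (X n)"
    and "\<And>n. n \<ge> 1 \<Longrightarrow> u n \<in> servers (G n)"
    and "skewed_neighborhood G lam mu u"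
  shows "\<forall>k::nat.
    (\<lambda>n. Liminf at_top (\<lambda>t::real. ereal (\<P>(w in M n. X n t w (u n) \<ge> k)))) \<longlonglongrightarrow> 1"
proof
  fix k :: nat
  let ?P = "\<lambda>n t. \<P>(w in M n. X n t w (u n) \<ge> k)"
  let ?L = "\<lambda>n. Liminf at_top (\<lambda>t::real. ereal (?P n t))"
  obtain a l m where lm: "l > 0" "m > 0" and lim: "filterlim
      (\<lambda>n. card (alpha_neighborhood (G n) (lam n) (mu n) (a, l, m) (u n))) at_top sequentially"
    using assms(6) unfolding skewed_neighborhood_def by blast
  show "?L \<longlonglongrightarrow> 1"
  proof (rule order_tendstoI)
    fix y :: ereal assume "y < 1"
    then obtain z where z: "y < ereal z" "ereal z < 1" using ereal_dense2 by blast
    \<comment> \<open>Since \<open>B\<close> does not involve \<open>n\<close>, a sunflower size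
      \<open>r\<close> that makes the error smaller than \<open>1 - z\<close> can be fixed for all
      networks.\<close>
    define B where "B = deficit_const a l m k"
    have "eventually (\<lambda>r. B / real r < 1 - z) sequentially"
      using z(2) by (intro order_tendstoD(2)[OF lim_const_over_n]) simp
    then obtain r where r: "r \<ge> 1" "B / real r < 1 - z"
      using eventually_happens[OF eventually_conj[OF eventually_ge_at_top[of 1]]] by fastforce
    from sunflower_lemma[of a r] obtain F where F: "\<forall>(N :: 'd \<Rightarrow> 's set) A C0. finite A \<longrightarrow>
        (\<forall>d\<in>A. finite (N d) \<and> C0 \<subseteq> N d \<and> card (N d - C0) \<le> a) \<longrightarrow> F \<le> card A \<longrightarrow>
        (\<exists>R C. R \<subseteq> A \<and> card R = r \<and> C0 \<subseteq> C \<and> (\<forall>d\<in>R. C \<subseteq> N d) \<and>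
           (\<forall>d\<in>R. \<forall>e\<in>R. d \<noteq> e \<longrightarrow> N d \<inter> N e = C))"
      ..
    have "\<forall>\<^sub>F n in sequentially. F \<le> card (alpha_neighborhood (G n) (lam n) (mu n) (a, l, m) (u n))"
      using lim unfolding filterlim_at_top by blast
    thus "\<forall>\<^sub>F n in sequentially. y < ?L n"
      using eventually_ge_at_top[of 1]
    proof eventually_elim
      case (elim n)
      let ?N = "compatible_servers (G n)"
      let ?A = "alpha_neighborhood (G n) (lam n) (mu n) (a, l, m) (u n)"
      have net: "is_network (G n)" by (rule assms(1)[OF elim(2)])
      have A: "d \<in> dispatchers (G n)" "u n \<in> ?N d" "degree (G n) d \<le> a" "l \<le> lam n d"
        "\<And>v. v \<in> ?N d \<Longrightarrow> mu n v \<le> m" if "d \<in> ?A" for d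
        using that assms(5)[OF elim(2)]
        by (auto simp: alpha_neighborhood_def compatible_dispatchers_def compatible_servers_def)
      have "finite ?A" using A(1) net finite_subset[of ?A "dispatchers (G n)"] by (auto simp: is_network_def)
      moreover have fin: "finite (?N d)" for d using net by (auto simp: is_network_def compatible_servers_def)
      moreover have "card (?N d - {u n}) \<le> a" if "d \<in> ?A" for d
        using A(3)[OF that] card_mono[OF fin[of d], of "?N d - {u n}"] by (auto simp: degree_def)
      \<comment> \<open>Starting from the kernel \<open>{u n}\<close> guarantees that the core
        contains \<open>u n\<close>.\<close>
      ultimately have "\<exists>R C. R \<subseteq> ?A \<and> card R = r \<and> {u n} \<subseteq> C \<and> (\<forall>d\<in>R. C \<subseteq> ?N d) \<and>
          (\<forall>d\<in>R. \<forall>e\<in>R. d \<noteq> e \<longrightarrow> ?N d \<inter> ?N e = C)"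
        using A(2) elim(1) by (intro F[rule_format]) auto
      then obtain R C where RC: "R \<subseteq> ?A" "card R = r" "u n \<in> C" "\<And>d. d \<in> R \<Longrightarrow> C \<subseteq> ?N d"
        "\<And>d e. d \<in> R \<Longrightarrow> e \<in> R \<Longrightarrow> d \<noteq> e \<Longrightarrow> ?N d \<inter> ?N e = C"
        by auto
      interpret sunflower_process "G n" "lam n" "mu n" R C a l m "M n" "X n"
      proof
        show "R \<noteq> {}" using RC(2) r(1) by auto
        show "R \<subseteq> dispatchers (G n)" using RC(1) A(1) by auto
        show "d \<in> R \<Longrightarrow> mu n v \<le> m" if "v \<in> ?N d" for d v using RC(1) A(5) that by blast
      qed (use net assms(2-4) elim(2) lm RC A(3,4) in auto)
      have "\<forall>\<^sub>F t in at_top. ereal z \<le> ereal (?P n t)"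
        using eventually_prob_ge[OF RC(3), of k]
        by eventually_elim (use r in \<open>simp add: RC(2) B_def\<close>)
      hence "ereal z \<le> ?L n" by (rule Liminf_bounded)
      thus ?case using z(1) by (rule less_le_trans[rotated])
    qed
  next
    fix y :: ereal assume y: "1 < y"
    \<comment> \<open>The upper half holds because probabilities are at most 1.\<close>
    have "?L n < y" if n: "n \<ge> 1" for n
    proof -
      interpret prob_space "M n"
        using assms(4)[OF n] by (simp add: load_balancing_process_def markov_chain_def)
      have "?L n \<le> Limsup at_top (\<lambda>t::real. ereal (?P n t))" by (intro Liminf_le_Limsup) simp
      also have "\<dots> \<le> 1" by (intro Limsup_bounded) simp
      finally show ?thesis using y by (rule le_less_trans)
    qed
    thus "\<forall>\<^sub>F n in sequentially. ?L n < y" by (auto simp: eventually_sequentially)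
  qed
qed

end
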